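(* Let $n\in\mathbb{N}=\{1,2,\dots\}$ and let $I=\{i_1<\dots<i_l\}\subseteq\{0,1,\dots,n-1\}$. Then $$\sum_{w\in B_n^{I^c}}(-1)^{l(w)}X^{L(w)}=f_{n,I}(X).$$
   Context: The hyperoctahedral group $B_n$ is the group of bijections $w$ of $\{-n,\dots,n\}$ with $w(-i)=-w(i)$ for all $i$ (so $w(0)=0$); write $w=[w(1),\dots,w(n)]$. It is a Coxeter group with generators $s_0=[-1,2,3,\dots,n]$ and $s_i=[1,\dots,i-1,i+1,i,i+2,\dots,n]$ for $1\le i\le n-1$; $l(w)$ denotes the Coxeter length. The descent set is $D(w)=\{i\in\{0,\dots,n-1\}: w(i)>w(i+1)\}$ (using $w(0)=0$). For $I\subseteq\{0,\dots,n-1\}$ write $I^c=\{0,\dots,n-1\}\setminus I$ and $B_n^{I^c}=\{w\in B_n: D(w)\subseteq I\}$. The statistic $L$ is $$L(w)=\tfrac12\left|\{(i,j)\in\{-n,\dots,n\}^2: i<j,\ w(i)>w(j),\ i\not\equiv j \pmod 2\}\right|.$$ Polynomials in $X$: $(\underline{k})=1-X^k$ for $k>0$ and $(\underline{0})=1$; $(\underline{k})!=\prod_{i=1}^k(\underline{i})$ (so $(\underline 0)!=1$); $(\underline{k})!!=\prod_{1\le i\le k,\ i\text{ even}}(\underline{i})$. For $I=\{i_1<\dots<i_l\}$ with $l\ge1$ put $j_t=i_{t+1}-i_t$ for $1\le t<l$ and $j_l=n-i_l$, and $$f_{n,I}(X)=\frac{(\underline n)!}{(\underline{i_1})!\cdot\prod_{k=1}^{l}(\underline{j_k})!!}.$$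 For $I=\emptyset$, $f_{n,\emptyset}(X)=1$. *)

theory Defs
  imports
    "HOL-Combinatorics.Permutations"
    "HOL-Computational_Algebra.Polynomial_Factorial"
begin

text \<open>
  Elements of the group are functions on all of \<open>int\<close> that are the identity outside
  \<open>{-n..n}\<close>, so that each signed permutation has exactly one representative.
\<close>
definition hyperoct :: "nat \<Rightarrow> (int \<Rightarrow> int) set" where
  "hyperoct n = {w. w permutes {- int n..int n} \<and> (\<forall>i\<in>{- int n..int n}. w (- i) = - w i)}"

definition coxeter_gen :: "nat \<Rightarrow> int \<Rightarrow> int" where
  "coxeter_gen i =
     (if i = 0 then transpose (- 1) 1
      else transpose (int i) (int i + 1) \<circ> transpose (- int i) (- (int i + 1)))"

definition coxeter_length :: "nat \<Rightarrow> (int \<Rightarrow> int) \<Rightarrow> nat" where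
  "coxeter_length n w =
     (LEAST k. \<exists>is. length is = k \<and> set is \<subseteq> {0..<n} \<and> w = foldr (\<circ>) (map coxeter_gen is) id)"

definition descents :: "nat \<Rightarrow> (int \<Rightarrow> int) \<Rightarrow> nat set" where
  "descents n w = {i \<in> {0..<n}. w (int i) > w (int i + 1)}"

text \<open>
  \<open>hyperoct_desc n I\<close> is the parabolic quotient written \<open>B\<^sub>n\<close> with superscript \<open>{0..<n} - I\<close>.
\<close>
definition hyperoct_desc :: "nat \<Rightarrow> nat set \<Rightarrow> (int \<Rightarrow> int) set" where
  "hyperoct_desc n I = {w \<in> hyperoct n. descents n w \<subseteq> I}"

definition odd_inversions :: "nat \<Rightarrow> (int \<Rightarrow> int) \<Rightarrow> (int \<times> int) set" where
  "odd_inversions n w =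
     {(i, j) \<in> {- int n..int n} \<times> {- int n..int n}. i < j \<and> w i > w j \<and> \<not> i mod 2 = j mod 2}"

definition odd_length :: "nat \<Rightarrow> (int \<Rightarrow> int) \<Rightarrow> nat" where
  "odd_length n w = card (odd_inversions n w) div 2"

text \<open>The division by two in \<^const>\<open>odd_length\<close> is exact:\<close>
lemma even_card_odd_inversions:
  assumes "w \<in> hyperoct n"
  shows "even (card (odd_inversions n w))"
proof -
  let ?A = "{p \<in> odd_inversions n w. fst p + snd p > 0}"
  let ?B = "{p \<in> odd_inversions n w. fst p + snd p < 0}"
  let ?f = "\<lambda>(i, j). (- j, - i) :: int \<times> int"
  have fin: "finite (odd_inversions n w)"
    by (rule finite_subset[of _ "{- int n..int n} \<times> {- int n..int n}"])
       (auto simp: odd_inversions_def)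
  have closed: "?f p \<in> odd_inversions n w" if "p \<in> odd_inversions n w" for p
  proof -
    obtain i j where p: "p = (i, j)" by (cases p)
    have "w (- i) = - w i" "w (- j) = - w j"
      using assms that by (auto simp: p hyperoct_def odd_inversions_def)
    moreover have "- j mod 2 \<noteq> - i mod 2" if "i mod 2 \<noteq> j mod 2"
      using that by presburger
    ultimately show ?thesis
      using that by (auto simp: p odd_inversions_def)
  qed
  have "bij_betw ?f ?A ?B"
  proof (rule bij_betw_byWitness[where f' = ?f])
    show "?f ` ?A \<subseteq> ?B" using closed by fastforce
    show "?f ` ?B \<subseteq> ?A" using closed by fastforce
  qed auto
  then have eq: "card ?A = card ?B"
    by (rule bij_betw_same_card)
  have "i + j \<noteq> 0" if "(i, j) \<in> odd_inversions n w" for i j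
  proof -
    have "i mod 2 \<noteq> j mod 2" using that by (simp add: odd_inversions_def)
    then show ?thesis by presburger
  qed
  then have un: "odd_inversions n w = ?A \<union> ?B"
    by (force simp: neq_iff)
  have "card (?A \<union> ?B) = card ?A + card ?B"
    by (rule card_Un_disjoint) (use fin in auto)
  then show ?thesis
    using eq un by simp
qed

definition qnum :: "nat \<Rightarrow> int poly" where
  "qnum k = (if k = 0 then 1 else 1 - monom 1 k)"

definition qfact :: "nat \<Rightarrow> int poly" where
  "qfact k = (\<Prod>i = 1..k. qnum i)"

definition qdfact :: "nat \<Rightarrow> int poly" where
  "qdfact k = (\<Prod>i \<in> {i \<in> {1..k}. even i}. qnum i)"

text \<open>
  For \<open>I = {i\<^sub>1 < \<dots> < i\<^sub>l}\<close> and \<open>1 \<le> t \<le> l\<close>, \<open>elt I t\<close> is \<open>i\<^sub>t\<close> and \<open>gap n I t\<close> is \<open>j\<^sub>t\<close>.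
\<close>
definition elt :: "nat set \<Rightarrow> nat \<Rightarrow> nat" where
  "elt I t = sorted_list_of_set I ! (t - 1)"

definition gap :: "nat \<Rightarrow> nat set \<Rightarrow> nat \<Rightarrow> nat" where
  "gap n I t = (if t < card I then elt I (t + 1) - elt I t else n - elt I t)"

text \<open>
  The quotient is taken in the fraction field of the polynomial ring, so that no divisibility
  is presupposed.
\<close>
definition f_frac :: "nat \<Rightarrow> nat set \<Rightarrow> int poly fract" where
  "f_frac n I =
     (if I = {} then 1
      else to_fract (qfact n) /
           to_fract (qfact (elt I 1) * (\<Prod>k = 1..card I. qdfact (gap n I k))))"

end

theory Submission imports Defs
begin

text \<open>
  Write every \<open>w\<close> with descents in \<open>I\<close> as \<open>w = u \<circ> v\<close>, where \<open>m\<close> is the largest element of \<open>I\<close>,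
  \<open>u\<close> has its only descent at \<open>m\<close>, and \<open>v\<close> is a signed permutation of \<open>{- m..m}\<close>. For fixed \<open>u\<close>,
  multiplying \<open>v\<close> from the left by a generator that exchanges two values in positions of equal
  parity changes the sign but not \<open>L(w)\<close>; hence only the parity-preserving \<open>v\<close> contribute, and for
  these \<open>L(u \<circ> v) = L(u) + L(v)\<close>. So the sum for \<open>(n, I)\<close> is the product of the sums for \<open>(n, {m})\<close>
  and \<open>(m, I - {m})\<close>. In the case of a single descent, deleting the value \<open>\<plusminus>n\<close>, which can only sit at
  position \<open>n\<close>, \<open>m\<close> or \<open>m + 1\<close>, gives a recursion between \<open>L\<close> and the variant of \<open>L\<close> in which the
  parity condition is reversed for pairs of positions on different sides of \<open>m\<close>. Both sums have a
  closed form.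
\<close>

section \<open>Order-preserving permutations\<close>

lemma strict_mono_on_int_intervalI:
  fixes f :: "int \<Rightarrow> 'a::order"
  assumes "\<And>i. a \<le> i \<Longrightarrow> i < b \<Longrightarrow> f i < f (i + 1)"
  shows "strict_mono_on {a..b} f"
proof (rule strict_mono_onI)
  fix i j assume "i \<in> {a..b}" "j \<in> {a..b}" "i < j"
  have "j \<le> b \<longrightarrow> f i < f j"
    using \<open>i < j\<close>
  proof (induction j rule: int_gr_induct)
    case base
    then show ?case using assms[of i] \<open>i \<in> {a..b}\<close> by simp
  next
    case (step k)
    then show ?case using assms[of k] \<open>i \<in> {a..b}\<close> by (auto intro: less_trans)
  qed
  then show "f i < f j" using \<open>j \<in> {a..b}\<close> by simp
qed

lemma permutes_strict_mono_on_eq_id: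
  fixes p :: "'a::linorder \<Rightarrow> 'a"
  assumes "finite S" and p: "p permutes S" and mono: "strict_mono_on S p"
  shows "p = id"
proof -
  let ?xs = "sorted_list_of_set S"
  have "sorted (map p ?xs)"
    unfolding sorted_map
    by (rule sorted_wrt_mono_rel[OF _ sorted_sorted_list_of_set])
       (use \<open>finite S\<close> strict_mono_on_less_eq[OF mono] in simp)
  then have "map p ?xs = ?xs"
    using \<open>finite S\<close> p
    by (intro sorted_distinct_set_unique) (auto simp: distinct_map permutes_inj_on permutes_image)
  then have "p x = x" if "x \<in> S" for x
    using that \<open>finite S\<close> map_eq_conv[of p ?xs id] by simp
  then show ?thesis
    using permutes_not_in[OF p] by fastforce
qed

lemma ex_strict_mono_bij_betw:
  fixes A :: "'a::linorder set" and B :: "'b::linorder set"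
  assumes "finite A" "finite B" "card A = card B"
  obtains h where "bij_betw h A B" "strict_mono_on A h"
proof -
  define a where "a k = sorted_list_of_set A ! k" for k
  define b where "b k = sorted_list_of_set B ! k" for k
  let ?n = "card A"
  have a: "bij_betw a {..<?n} A" "strict_mono_on {..<?n} a"
    and b: "bij_betw b {..<?n} B" "strict_mono_on {..<?n} b"
    using assms unfolding a_def b_def
    by (auto intro!: bij_betw_nth strict_mono_onI sorted_wrt_nth_less[OF strict_sorted_list_of_set])
  let ?h = "b \<circ> the_inv_into {..<?n} a"
  have "bij_betw ?h A B"
    using bij_betw_trans[OF bij_betw_the_inv_into[OF a(1)] b(1)] .
  moreover have "strict_mono_on A ?h"
  proof (rule strict_mono_onI)
    fix x y assume "x \<in> A" "y \<in> A" "x < y"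
    then obtain i j where ij: "i < ?n" "j < ?n" "x = a i" "y = a j"
      using bij_betw_imp_surj_on[OF a(1)] by blast
    then have "i < j" using strict_mono_on_less[OF a(2)] \<open>x < y\<close> by simp
    then have "b i < b j" using strict_mono_onD[OF b(2)] ij by simp
    then show "?h x < ?h y"
      using ij the_inv_into_f_f[OF bij_betw_imp_inj_on[OF a(1)]] by simp
  qed
  ultimately show ?thesis by (rule that)
qed

definition same_order_on :: "'a set \<Rightarrow> ('a \<Rightarrow> 'b::ord) \<Rightarrow> ('a \<Rightarrow> 'c::ord) \<Rightarrow> bool" where
  "same_order_on S f g \<longleftrightarrow> (\<forall>i\<in>S. \<forall>j\<in>S. f i < f j \<longleftrightarrow> g i < g j)"

lemma same_order_on_comp_inv_strict_mono:
  assumes v: "v permutes S" and order: "same_order_on S v f"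
  shows "strict_mono_on S (f \<circ> inv v)"
proof (rule strict_mono_onI)
  fix x y assume xy: "x \<in> S" "y \<in> S" "x < y"
  have "inv v x \<in> S" "inv v y \<in> S"
    using xy permutes_in_image[OF permutes_inv[OF v]] by auto
  moreover have "v (inv v x) < v (inv v y)"
    using xy permutes_inverses(1)[OF v] by simp
  ultimately show "(f \<circ> inv v) x < (f \<circ> inv v) y"
    using order by (simp add: same_order_on_def)
qed

lemma same_order_on_strict_mono_comp:
  fixes u :: "'a::linorder \<Rightarrow> 'b::preorder"
  assumes "strict_mono_on S u" and "v permutes S"
  shows "same_order_on S v (u \<circ> v)"
  using strict_mono_on_less[OF assms(1)] permutes_in_image[OF assms(2)]
  by (simp add: same_order_on_def)

lemma ex1_standardization:
  fixes S :: "'a::linorder set" and f :: "'a \<Rightarrow> 'b::linorder"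
  assumes "finite S" and "inj_on f S"
  shows "\<exists>!v. v permutes S \<and> same_order_on S v f"
proof (rule ex_ex1I)
  obtain h where h: "bij_betw h (f ` S) S" "strict_mono_on (f ` S) h"
    using ex_strict_mono_bij_betw[of "f ` S" S] assms by (metis card_image finite_imageI)
  let ?v = "\<lambda>i. if i \<in> S then h (f i) else i"
  have "bij_betw (h \<circ> f) S S"
    using bij_betw_trans[OF inj_on_imp_bij_betw[OF \<open>inj_on f S\<close>] h(1)] .
  then have "bij_betw ?v S S" by (simp cong: bij_betw_cong)
  then have "?v permutes S" by (rule bij_imp_permutes) simp
  moreover have "same_order_on S ?v f"
    using strict_mono_on_less[OF h(2)] by (simp add: same_order_on_def)
  ultimately show "\<exists>v. v permutes S \<and> same_order_on S v f" by blast
next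
  fix v v'
  assume v: "v permutes S \<and> same_order_on S v f" and v': "v' permutes S \<and> same_order_on S v' f"
  then have "same_order_on S v v'" by (simp add: same_order_on_def)
  then have "strict_mono_on S (v' \<circ> inv v)"
    using v by (intro same_order_on_comp_inv_strict_mono) simp_all
  then have "v' \<circ> inv v = id"
    using \<open>finite S\<close> v v'
    by (intro permutes_strict_mono_on_eq_id[of S] permutes_compose permutes_inv) simp_all
  then show "v = v'"
    using permutes_inverses(2) v by (metis comp_apply ext id_apply)
qed

section \<open>Signed permutations\<close>

lemma hyperoct_permutes: "w \<in> hyperoct n \<Longrightarrow> w permutes {- int n..int n}"
  by (simp add: hyperoct_def)

lemma hyperoctI: "w permutes {- int n..int n} \<Longrightarrow> (\<And>i. w (- i) = - w i) \<Longrightarrow> w \<in> hyperoct n"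
  by (simp add: hyperoct_def)

lemma hyperoct_fixed: "w \<in> hyperoct n \<Longrightarrow> \<bar>i\<bar> > int n \<Longrightarrow> w i = i"
  by (rule permutes_not_in[OF hyperoct_permutes]) auto

lemma hyperoct_minus:
  assumes "w \<in> hyperoct n"
  shows "w (- i) = - w i"
proof (cases "\<bar>i\<bar> \<le> int n")
  case True
  then show ?thesis using assms by (auto simp: hyperoct_def abs_le_iff)
next
  case False
  then show ?thesis using hyperoct_fixed[OF assms, of i] hyperoct_fixed[OF assms, of "- i"] by simp
qed

lemma hyperoct_zero: "w \<in> hyperoct n \<Longrightarrow> w 0 = 0"
  using hyperoct_minus[of w n 0] by simp

lemma hyperoct_id: "id \<in> hyperoct n"
  by (simp add: hyperoct_def permutes_id)

lemma hyperoct_comp: "u \<in> hyperoct n \<Longrightarrow> v \<in> hyperoct n \<Longrightarrow> u \<circ> v \<in> hyperoct n"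
  by (intro hyperoctI permutes_compose) (auto simp: hyperoct_permutes hyperoct_minus)

lemma hyperoct_apply_inv: "w \<in> hyperoct n \<Longrightarrow> w (inv w i) = i"
  using permutes_inverses(1) hyperoct_permutes by metis

lemma hyperoct_inv_apply: "w \<in> hyperoct n \<Longrightarrow> inv w (w i) = i"
  using permutes_inverses(2) hyperoct_permutes by metis

lemma hyperoct_comp_inv: "w \<in> hyperoct n \<Longrightarrow> w \<circ> inv w = id" "w \<in> hyperoct n \<Longrightarrow> inv w \<circ> w = id"
  using permutes_inv_o hyperoct_permutes by blast+

lemma hyperoct_eq_iff: "w \<in> hyperoct n \<Longrightarrow> w i = w j \<longleftrightarrow> i = j"
  by (metis hyperoct_inv_apply)

lemma hyperoct_inv:
  assumes "w \<in> hyperoct n"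
  shows "inv w \<in> hyperoct n"
proof (rule hyperoctI)
  show "inv w permutes {- int n..int n}"
    using assms by (simp add: hyperoct_permutes permutes_inv)
  show "inv w (- i) = - inv w i" for i
    using assms by (metis hyperoct_minus hyperoct_inv_apply hyperoct_apply_inv)
qed

lemma hyperoct_mono: "m \<le> n \<Longrightarrow> w \<in> hyperoct m \<Longrightarrow> w \<in> hyperoct n"
  by (rule hyperoctI) (auto intro: permutes_subset hyperoct_permutes simp: hyperoct_minus)

lemma hyperoct_abs_le: "w \<in> hyperoct n \<Longrightarrow> \<bar>w i\<bar> \<le> int n \<longleftrightarrow> \<bar>i\<bar> \<le> int n"
  using permutes_in_image[OF hyperoct_permutes, of w n i] by (auto simp: abs_le_iff)

lemma hyperoct_abs_eq_iff:
  assumes "w \<in> hyperoct n"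
  shows "\<bar>w i\<bar> = \<bar>w j\<bar> \<longleftrightarrow> \<bar>i\<bar> = \<bar>j\<bar>"
  using hyperoct_eq_iff[OF assms, of i j] hyperoct_eq_iff[OF assms, of i "- j"]
  by (auto simp: abs_eq_iff hyperoct_minus[OF assms])

lemma finite_hyperoct: "finite (hyperoct n)"
  by (rule finite_subset[OF _ finite_permutations[of "{- int n..int n}"]])
     (auto simp: hyperoct_permutes)

lemma hyperoct_descD: "w \<in> hyperoct_desc n I \<Longrightarrow> w \<in> hyperoct n"
  by (simp add: hyperoct_desc_def)

lemma finite_hyperoct_desc: "finite (hyperoct_desc n I)"
  using finite_hyperoct by (simp add: hyperoct_desc_def)

lemma not_descent_iff:
  assumes "w \<in> hyperoct n" "i < n"
  shows "i \<notin> descents n w \<longleftrightarrow> w (int i) < w (int i + 1)"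
  using hyperoct_eq_iff[OF assms(1), of "int i" "int i + 1"] assms(2) by (auto simp: descents_def)

lemma strict_mono_on_iff_no_descents:
  assumes w: "w \<in> hyperoct n" and "m \<le> n"
  shows "strict_mono_on {- int m..int m} w \<longleftrightarrow> descents n w \<inter> {..<m} = {}"
proof
  assume mono: "strict_mono_on {- int m..int m} w"
  have "i \<notin> descents n w" if "i < m" for i
    using strict_mono_onD[OF mono, of "int i" "int i + 1"] not_descent_iff[OF w, of i] that \<open>m \<le> n\<close>
    by simp
  then show "descents n w \<inter> {..<m} = {}" by blast
next
  assume no_desc: "descents n w \<inter> {..<m} = {}"
  have ascent: "w i < w (i + 1)" if "0 \<le> i" "i < int m" for i
    using no_desc that not_descent_iff[OF w, of "nat i"] \<open>m \<le> n\<close> by (force simp: nat_less_iff)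
  show "strict_mono_on {- int m..int m} w"
  proof (rule strict_mono_on_int_intervalI)
    fix i assume "- int m \<le> i" "i < int m"
    then show "w i < w (i + 1)"
      using ascent[of i] ascent[of "- (i + 1)"]
        hyperoct_minus[OF w, of i] hyperoct_minus[OF w, of "i + 1"]
      by (cases "0 \<le> i") auto
  qed
qed

lemma hyperoct_no_descents_eq_id:
  assumes w: "w \<in> hyperoct n" and "descents n w = {}"
  shows "w = id"
  using assms strict_mono_on_iff_no_descents[OF w, of n]
  by (intro permutes_strict_mono_on_eq_id[OF _ hyperoct_permutes[OF w]]) auto

lemma hyperoct_desc_no_descents:
  assumes "I \<inter> {..<n} = {}"
  shows "hyperoct_desc n I = {id}"
proof -
  have "descents n w \<subseteq> I \<longleftrightarrow> descents n w = {}" for w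
    using assms by (fastforce simp: descents_def)
  moreover have "descents n id = {}" by (simp add: descents_def)
  ultimately show ?thesis
    using hyperoct_no_descents_eq_id hyperoct_id by (auto simp: hyperoct_desc_def)
qed

section \<open>The parabolic factorization\<close>

lemma ex1_hyperoct_standardization:
  assumes w: "w \<in> hyperoct n"
  shows "\<exists>!v. v \<in> hyperoct m \<and> same_order_on {- int m..int m} v w"
proof -
  let ?S = "{- int m..int m}"
  have ex1: "\<exists>!v. v permutes ?S \<and> same_order_on ?S v w"
    by (rule ex1_standardization) (auto simp: inj_on_def hyperoct_eq_iff[OF w])
  have in_hyperoct: "v \<in> hyperoct m" if v: "v permutes ?S" and order: "same_order_on ?S v w" for v
  proof -
    define v' where "v' = uminus \<circ> v \<circ> uminus"
    have minus: "bij_betw uminus ?S ?S" by (auto simp: bij_betw_def)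
    have "bij_betw v ?S ?S" using v by (rule permutes_imp_bij)
    then have "bij_betw v' ?S ?S"
      unfolding v'_def by (intro bij_betw_trans[OF minus] bij_betw_trans[OF _ minus])
    moreover have "v' x = x" if "x \<notin> ?S" for x
      using permutes_not_in[OF v, of "- x"] that by (auto simp: v'_def)
    ultimately have "v' permutes ?S" by (rule bij_imp_permutes)
    moreover have "same_order_on ?S v' w"
      using order by (simp add: same_order_on_def v'_def hyperoct_minus[OF w])
    ultimately have "v' = v" using ex1 v order by blast
    then have "v (- i) = - v i" for i by (metis comp_apply minus_minus v'_def)
    then show ?thesis using v by (blast intro: hyperoctI)
  qed
  have "v \<in> hyperoct m \<and> same_order_on ?S v w \<longleftrightarrow> v permutes ?S \<and> same_order_on ?S v w" for v
    using in_hyperoct[of v] hyperoct_permutes[of v m] by fast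
  then show ?thesis using ex1 by presburger
qed

lemma ex_hyperoct_factorization:
  assumes w: "w \<in> hyperoct n" and "m \<le> n"
  obtains u v where "u \<in> hyperoct n" "strict_mono_on {- int m..int m} u"
    "v \<in> hyperoct m" "w = u \<circ> v"
proof -
  obtain v where v: "v \<in> hyperoct m" and order: "same_order_on {- int m..int m} v w"
    using ex1_hyperoct_standardization[OF w, of m] by blast
  have "strict_mono_on {- int m..int m} (w \<circ> inv v)"
    by (rule same_order_on_comp_inv_strict_mono[OF hyperoct_permutes[OF v] order])
  moreover have "w \<circ> inv v \<in> hyperoct n"
    using w v hyperoct_mono[OF \<open>m \<le> n\<close>] by (blast intro: hyperoct_comp hyperoct_inv)
  moreover have "w = (w \<circ> inv v) \<circ> v"
    by (simp add: comp_assoc hyperoct_comp_inv(2)[OF v])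
  ultimately show ?thesis using that v by blast
qed

lemma hyperoct_factorization_bij:
  assumes "m \<le> n"
  shows "bij_betw (\<lambda>(u, v). u \<circ> v)
    ({u \<in> hyperoct n. strict_mono_on {- int m..int m} u} \<times> hyperoct m) (hyperoct n)"
    (is "bij_betw ?comp (?U \<times> _) _")
proof -
  have comp: "u \<circ> v \<in> hyperoct n" if "u \<in> hyperoct n" "v \<in> hyperoct m" for u v
    using that hyperoct_mono[OF assms] by (blast intro: hyperoct_comp)
  have "inj_on ?comp (?U \<times> hyperoct m)"
  proof (rule inj_onI, clarify)
    fix u v u' v'
    assume u: "u \<in> hyperoct n" "strict_mono_on {- int m..int m} u" and v: "v \<in> hyperoct m"
      and u': "strict_mono_on {- int m..int m} u'" and v': "v' \<in> hyperoct m"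
      and eq: "u \<circ> v = u' \<circ> v'"
    have "same_order_on {- int m..int m} v (u \<circ> v)" "same_order_on {- int m..int m} v' (u \<circ> v)"
      using same_order_on_strict_mono_comp[OF u(2) hyperoct_permutes[OF v]]
        same_order_on_strict_mono_comp[OF u' hyperoct_permutes[OF v']]
      by (simp_all add: eq)
    then have "v = v'" using ex1_hyperoct_standardization[OF comp[OF u(1) v]] v v' by blast
    moreover from this have "u = u'"
      using eq hyperoct_comp_inv(1)[OF v] by (metis comp_assoc comp_id)
    ultimately show "u = u' \<and> v = v'" by simp
  qed
  moreover have "w \<in> ?comp ` (?U \<times> hyperoct m)" if w: "w \<in> hyperoct n" for w
  proof -
    obtain u v where "u \<in> hyperoct n" "strict_mono_on {- int m..int m} u"
      "v \<in> hyperoct m" "w = u \<circ> v"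
      using ex_hyperoct_factorization[OF w assms] .
    then show ?thesis by (intro rev_image_eqI[of "(u, v)"]) auto
  qed
  ultimately show ?thesis
    using comp unfolding bij_betw_def by (intro conjI subset_antisym image_subsetI subsetI) auto
qed

lemma descents_comp:
  assumes u: "u \<in> hyperoct n" and mono: "strict_mono_on {- int m..int m} u"
    and v: "v \<in> hyperoct m" and "m \<le> n"
  shows "descents n (u \<circ> v) - {m} = descents m v \<union> (descents n u - {m})"
proof -
  have "i \<in> descents n (u \<circ> v) - {m} \<longleftrightarrow> i \<in> descents m v \<union> (descents n u - {m})" for i
  proof (cases i m rule: linorder_cases)
    case less
    then have "u (v (int i + 1)) < u (v (int i)) \<longleftrightarrow> v (int i + 1) < v (int i)"
      using strict_mono_on_less[OF mono] permutes_in_image[OF hyperoct_permutes[OF v]] by simp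
    moreover have "i \<notin> descents n u"
      using less mono strict_mono_on_iff_no_descents[OF u \<open>m \<le> n\<close>] by blast
    ultimately show ?thesis using less \<open>m \<le> n\<close> by (simp add: descents_def)
  next
    case equal
    then show ?thesis by (simp add: descents_def)
  next
    case greater
    then show ?thesis
      using hyperoct_fixed[OF v, of "int i"] hyperoct_fixed[OF v, of "int i + 1"]
      by (auto simp: descents_def)
  qed
  then show ?thesis by blast
qed

lemma hyperoct_desc_factorization_bij:
  assumes "m < n" and J: "J \<subseteq> {..<m}"
  shows "bij_betw (\<lambda>(u, v). u \<circ> v) (hyperoct_desc n {m} \<times> hyperoct_desc m J)
    (hyperoct_desc n (insert m J))"
proof -
  let ?U = "{u \<in> hyperoct n. strict_mono_on {- int m..int m} u}"
  have "descents n (u \<circ> v) \<subseteq> insert m J \<longleftrightarrow> descents n u \<subseteq> {m} \<and> descents m v \<subseteq> J"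
    if "u \<in> ?U" "v \<in> hyperoct m" for u v
  proof -
    have "descents n u \<inter> J = {}"
      using that(1) J strict_mono_on_iff_no_descents[of u n m] \<open>m < n\<close> by auto
    moreover have "descents n (u \<circ> v) - {m} = descents m v \<union> (descents n u - {m})"
      using that \<open>m < n\<close> by (intro descents_comp) auto
    ultimately show ?thesis by blast
  qed
  then have "bij_betw (\<lambda>(u, v). u \<circ> v)
      {p \<in> ?U \<times> hyperoct m. descents n (fst p) \<subseteq> {m} \<and> descents m (snd p) \<subseteq> J}
      {w \<in> hyperoct n. descents n w \<subseteq> insert m J}"
    using \<open>m < n\<close> by (intro bij_betw_Collect[OF hyperoct_factorization_bij]) fastforce+
  moreover have "{p \<in> ?U \<times> hyperoct m. descents n (fst p) \<subseteq> {m} \<and> descents m (snd p) \<subseteq> J} =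
      hyperoct_desc n {m} \<times> hyperoct_desc m J"
    using strict_mono_on_iff_no_descents[of _ n m] \<open>m < n\<close> by (fastforce simp: hyperoct_desc_def)
  ultimately show ?thesis by (simp add: hyperoct_desc_def)
qed

section \<open>Inversions and the sign character\<close>

text \<open>
  Inversions come in pairs \<open>(i, j)\<close>, \<open>(- j, - i)\<close>; only the member with \<open>\<bar>i\<bar> < j\<close> is recorded. A pair
  \<open>(- j, j)\<close> is left out: it is an inversion if and only if \<open>(0, j)\<close> is.
\<close>
definition inversions :: "(int \<Rightarrow> int \<Rightarrow> bool) \<Rightarrow> nat \<Rightarrow> (int \<Rightarrow> int) \<Rightarrow> (int \<times> int) set" where
  "inversions Q n w = {(i, j). \<bar>i\<bar> < j \<and> j \<le> int n \<and> Q \<bar>i\<bar> j \<and> w j < w i}"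

abbreviation all_pairs :: "int \<Rightarrow> int \<Rightarrow> bool" where
  "all_pairs \<equiv> \<lambda>_ _. True"

definition opposite_parity :: "int \<Rightarrow> int \<Rightarrow> bool" where
  "opposite_parity a b \<longleftrightarrow> odd (a + b)"

lemma inversions_id: "inversions Q n id = {}"
  by (auto simp: inversions_def)

lemma finite_inversions: "finite (inversions Q n w)"
  by (rule finite_subset[of _ "{- int n..int n} \<times> {- int n..int n}"]) (auto simp: inversions_def)

lemma inversions_cong:
  assumes "\<And>a b. 0 \<le> a \<Longrightarrow> a < b \<Longrightarrow> b \<le> int n \<Longrightarrow> Q a b \<longleftrightarrow> Q' a b"
  shows "inversions Q n w = inversions Q' n w"
  using assms by (auto simp: inversions_def)

lemma inversions_hyperoct_mono:
  assumes w: "w \<in> hyperoct m" and "m \<le> n"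
  shows "inversions Q n w = inversions Q m w"
proof -
  have "\<not> w j < w i" if "\<bar>i\<bar> < j" "int m < j" for i j
    using that hyperoct_abs_le[OF w, of i] hyperoct_fixed[OF w, of i] hyperoct_fixed[OF w, of j]
    by (cases "\<bar>i\<bar> \<le> int m") auto
  then show ?thesis using \<open>m \<le> n\<close> unfolding inversions_def by force
qed

lemma descents_eq_inversions:
  "descents n w = {i. (int i, int i + 1) \<in> inversions opposite_parity n w}"
  by (auto simp: descents_def inversions_def opposite_parity_def)

lemma inversions_opposite_parity_eq:
  "inversions opposite_parity n w = {(i, j) \<in> odd_inversions n w. i + j > 0}"
proof -
  have "(i, j) \<in> inversions opposite_parity n w \<longleftrightarrow> (i, j) \<in> odd_inversions n w \<and> i + j > 0" for i j
    unfolding inversions_def odd_inversions_def opposite_parity_def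
    by (simp add: mod_2_eq_odd even_abs_add_iff) linarith
  then show ?thesis by auto
qed

lemma odd_length_eq_card_inversions:
  assumes w: "w \<in> hyperoct n"
  shows "odd_length n w = card (inversions opposite_parity n w)"
proof -
  let ?pos = "inversions opposite_parity n w" and ?mirror = "\<lambda>(i, j). (- j, - i) :: int \<times> int"
  have mirror: "(- j, - i) \<in> odd_inversions n w \<longleftrightarrow> (i, j) \<in> odd_inversions n w" for i j
    by (auto simp: odd_inversions_def hyperoct_minus[OF w] mod_2_eq_odd)
  have "odd_inversions n w = ?pos \<union> ?mirror ` ?pos"
  proof (intro set_eqI iffI)
    fix p assume p: "p \<in> odd_inversions n w"
    obtain i j where ij: "p = (i, j)" by (cases p)
    have "i + j \<noteq> 0" using p by (auto simp: ij odd_inversions_def add_eq_0_iff2 mod_2_eq_odd)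
    then have "(i, j) \<in> ?pos \<or> (- j, - i) \<in> ?pos"
      using p mirror[of j i] by (auto simp: ij inversions_opposite_parity_eq)
    then show "p \<in> ?pos \<union> ?mirror ` ?pos" by (force simp: ij)
  qed (auto simp: inversions_opposite_parity_eq mirror)
  moreover have "?pos \<inter> ?mirror ` ?pos = {}" by (auto simp: inversions_def)
  moreover have "inj_on ?mirror ?pos" by (auto simp: inj_on_def)
  ultimately have "card (odd_inversions n w) = 2 * card ?pos"
    by (simp add: card_Un_disjoint finite_inversions card_image)
  then show ?thesis by (simp add: odd_length_def)
qed

lemma coxeter_gen_apply:
  "coxeter_gen r x =
     (if r = 0 then if \<bar>x\<bar> = 1 then - x else x
      else if x = int r then int r + 1 else if x = int r + 1 then int r
      else if x = - int r then - (int r + 1) else if x = - (int r + 1) then - int r else x)"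
  by (auto simp: coxeter_gen_def transpose_def abs_if)

lemma coxeter_gen_involution: "coxeter_gen r \<circ> coxeter_gen r = id"
  by (auto simp: fun_eq_iff coxeter_gen_apply)

lemma coxeter_gen_involutory: "coxeter_gen r \<circ> (coxeter_gen r \<circ> w) = w"
  by (simp add: comp_assoc[symmetric] coxeter_gen_involution)

lemma coxeter_gen_hyperoct:
  assumes "r < n" shows "coxeter_gen r \<in> hyperoct n"
proof (rule hyperoctI)
  have "coxeter_gen r x = x" if "x \<notin> {- int n..int n}" for x
    using that assms by (auto simp: coxeter_gen_apply)
  then show "coxeter_gen r permutes {- int n..int n}"
    using coxeter_gen_involution[of r] by (auto simp: permutes_def fun_eq_iff) metis+
qed (auto simp: coxeter_gen_apply)

definition adjacent_values :: "nat \<Rightarrow> int \<Rightarrow> int \<Rightarrow> bool" where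
  "adjacent_values r x y \<longleftrightarrow>
     (x, y) \<in> {(int r, int r + 1), (int r + 1, int r),
       (- int r, - (int r + 1)), (- (int r + 1), - int r)}"

lemma coxeter_gen_less_iff:
  assumes "\<bar>x\<bar> \<noteq> \<bar>y\<bar>"
  shows "coxeter_gen r y < coxeter_gen r x \<longleftrightarrow> (y < x) \<noteq> adjacent_values r x y"
proof (cases "r = 0")
  case True
  then have "adjacent_values r x y \<longleftrightarrow> x = 0 \<and> \<bar>y\<bar> = 1 \<or> \<bar>x\<bar> = 1 \<and> y = 0"
    by (auto simp: adjacent_values_def)
  then show ?thesis
    using assms True by (simp add: coxeter_gen_apply) linarith
next
  case False
  then have "int r > 0" by simp
  moreover have "coxeter_gen r z = (if z = int r then int r + 1 else if z = int r + 1 then int r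
      else if z = - int r then - (int r + 1) else if z = - (int r + 1) then - int r else z)" for z
    using False by (simp add: coxeter_gen_apply)
  moreover have "adjacent_values r x y \<longleftrightarrow> x = int r \<and> y = int r + 1 \<or> x = int r + 1 \<and> y = int r \<or>
      x = - int r \<and> y = - (int r + 1) \<or> x = - (int r + 1) \<and> y = - int r"
    by (simp add: adjacent_values_def)
  ultimately show ?thesis
    using assms by smt
qed

lemma adjacent_values_positions:
  assumes w: "w \<in> hyperoct n" and a: "w a = int r" and b: "w b = int r + 1"
  shows "adjacent_values r (w i) (w j) \<longleftrightarrow> (i, j) \<in> {(a, b), (b, a), (- a, - b), (- b, - a)}"
proof -
  have "int r = w a" "int r + 1 = w b" "- int r = w (- a)" "- (int r + 1) = w (- b)"
    using a b by (simp_all add: hyperoct_minus[OF w])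
  then show ?thesis
    by (simp only: adjacent_values_def insert_iff empty_iff prod.inject hyperoct_eq_iff[OF w])
qed

lemma ex_adjacent_values_position:
  assumes w: "w \<in> hyperoct n" and "r < n"
  obtains i j where "\<bar>i\<bar> < j" "j \<le> int n" "adjacent_values r (w i) (w j)"
proof -
  define a b where "a = inv w (int r)" and "b = inv w (int r + 1)"
  have a: "w a = int r" and b: "w b = int r + 1"
    by (simp_all add: a_def b_def hyperoct_apply_inv[OF w])
  have neq: "\<bar>a\<bar> \<noteq> \<bar>b\<bar>" and le: "\<bar>a\<bar> \<le> int n" "\<bar>b\<bar> \<le> int n"
    using hyperoct_abs_eq_iff[OF w, of a b] hyperoct_abs_le[OF w, of a] hyperoct_abs_le[OF w, of b]
      a b \<open>r < n\<close> by auto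
  note adjacent = adjacent_values_positions[OF w a b]
  consider "\<bar>a\<bar> < b" | "\<bar>- a\<bar> < - b" | "\<bar>b\<bar> < a" | "\<bar>- b\<bar> < - a"
    using neq by linarith
  then show ?thesis
  proof cases
    case 1
    then show ?thesis by (rule that) (use le in \<open>simp_all add: adjacent\<close>)
  next
    case 2
    then show ?thesis by (rule that) (use le in \<open>simp_all add: adjacent\<close>)
  next
    case 3
    then show ?thesis by (rule that) (use le in \<open>simp_all add: adjacent\<close>)
  next
    case 4
    then show ?thesis by (rule that) (use le in \<open>simp_all add: adjacent\<close>)
  qed
qed

lemma adjacent_values_position_unique:
  assumes w: "w \<in> hyperoct n" and "\<bar>i\<bar> < j" "adjacent_values r (w i) (w j)"
    and "\<bar>i'\<bar> < j'" "adjacent_values r (w i') (w j')"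
  shows "(i', j') = (i, j)"
  using assms(2-)
  unfolding adjacent_values_positions[OF w hyperoct_apply_inv[OF w] hyperoct_apply_inv[OF w]]
  by auto

lemma inversions_coxeter_gen_comp:
  assumes w: "w \<in> hyperoct n" and ij: "\<bar>i\<bar> < j" "j \<le> int n" "adjacent_values r (w i) (w j)"
  shows "inversions Q n (coxeter_gen r \<circ> w) =
    (if Q \<bar>i\<bar> j then sym_diff (inversions Q n w) {(i, j)} else inversions Q n w)"
proof -
  have "coxeter_gen r (w j') < coxeter_gen r (w i') \<longleftrightarrow> (w j' < w i') \<noteq> ((i', j') = (i, j))"
    if "\<bar>i'\<bar> < j'" for i' j'
  proof -
    have "adjacent_values r (w i') (w j') \<longleftrightarrow> (i', j') = (i, j)"
      using adjacent_values_position_unique[OF w ij(1,3) that] ij(3) by blast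
    then show ?thesis
      using coxeter_gen_less_iff[of "w i'" "w j'" r] that by (simp add: hyperoct_abs_eq_iff[OF w])
  qed
  then show ?thesis using ij by (auto simp: inversions_def)
qed

lemma ex_coxeter_gen_fewer_inversions:
  assumes w: "w \<in> hyperoct n" and "w \<noteq> id"
  obtains r where "r < n"
    "card (inversions all_pairs n (coxeter_gen r \<circ> w)) < card (inversions all_pairs n w)"
proof -
  have "inv w \<noteq> id"
    using \<open>w \<noteq> id\<close> hyperoct_comp_inv(1)[OF w] by auto
  then obtain r where "r \<in> descents n (inv w)"
    using hyperoct_no_descents_eq_id[OF hyperoct_inv[OF w]] by blast
  then have r: "r < n" and desc: "inv w (int r + 1) < inv w (int r)"
    by (simp_all add: descents_def)
  obtain i j where ij: "\<bar>i\<bar> < j" "j \<le> int n" "adjacent_values r (w i) (w j)"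
    using ex_adjacent_values_position[OF w r] .
  have "(i, j) = (inv w (int r + 1), inv w (int r)) \<or>
      (i, j) = (- inv w (int r), - inv w (int r + 1))"
    using ij(1,3) desc
    unfolding adjacent_values_positions[OF w hyperoct_apply_inv[OF w] hyperoct_apply_inv[OF w]]
    by auto
  then have "w j < w i"
    by (auto simp: hyperoct_apply_inv[OF w] hyperoct_minus[OF w])
  then have "(i, j) \<in> inversions all_pairs n w" using ij by (simp add: inversions_def)
  moreover from this
  have "inversions all_pairs n (coxeter_gen r \<circ> w) = inversions all_pairs n w - {(i, j)}"
    using inversions_coxeter_gen_comp[OF w ij, of all_pairs] by auto
  ultimately
  have "card (inversions all_pairs n (coxeter_gen r \<circ> w)) < card (inversions all_pairs n w)"
    using card_Diff1_less[OF finite_inversions] by simp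
  then show ?thesis using that r by blast
qed

lemma hyperoct_induct [consumes 1, case_names id gen]:
  assumes "w \<in> hyperoct n" and "P id"
    and "\<And>r w. r < n \<Longrightarrow> w \<in> hyperoct n \<Longrightarrow> P w \<Longrightarrow> P (coxeter_gen r \<circ> w)"
  shows "P w"
  using assms(1)
proof (induction "card (inversions all_pairs n w)" arbitrary: w rule: less_induct)
  case less
  show ?case
  proof (cases "w = id")
    case False
    then obtain r where r: "r < n"
      "card (inversions all_pairs n (coxeter_gen r \<circ> w)) < card (inversions all_pairs n w)"
      using ex_coxeter_gen_fewer_inversions[OF less.prems] by blast
    have gen_w: "coxeter_gen r \<circ> w \<in> hyperoct n"
      using r less.prems by (intro hyperoct_comp coxeter_gen_hyperoct)
    have "P (coxeter_gen r \<circ> (coxeter_gen r \<circ> w))"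
      by (rule assms(3)[OF r(1) gen_w less.hyps[OF r(2) gen_w]])
    then show ?thesis by (simp only: coxeter_gen_involutory)
  qed (simp only: \<open>P id\<close>)
qed

definition coxeter_sign :: "nat \<Rightarrow> (int \<Rightarrow> int) \<Rightarrow> 'a::comm_ring_1" where
  "coxeter_sign n w = (- 1) ^ card (inversions all_pairs n w)"

lemma power_minus1_card_sym_diff_singleton:
  assumes "finite A"
  shows "(- 1 :: 'a::comm_ring_1) ^ card (sym_diff A {x}) = - ((- 1) ^ card A)"
proof (cases "x \<in> A")
  case True
  then have "sym_diff A {x} = A - {x}" by blast
  then show ?thesis using card.remove[OF assms True] by simp
next
  case False
  then have "sym_diff A {x} = insert x A" by blast
  then show ?thesis using False assms by simp
qed

lemma coxeter_sign_id: "coxeter_sign n id = 1"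
  by (simp add: coxeter_sign_def inversions_id)

lemma coxeter_sign_mono: "w \<in> hyperoct m \<Longrightarrow> m \<le> n \<Longrightarrow> coxeter_sign n w = coxeter_sign m w"
  using inversions_hyperoct_mono[of w m n all_pairs] by (simp add: coxeter_sign_def)

lemma coxeter_sign_gen_comp:
  assumes "w \<in> hyperoct n" "r < n"
  shows "coxeter_sign n (coxeter_gen r \<circ> w) = - coxeter_sign n w"
proof -
  obtain i j where "\<bar>i\<bar> < j" "j \<le> int n" "adjacent_values r (w i) (w j)"
    using ex_adjacent_values_position[OF assms] .
  note eq = inversions_coxeter_gen_comp[OF assms(1) this, of all_pairs]
  show ?thesis
    by (simp only: coxeter_sign_def eq if_True
        power_minus1_card_sym_diff_singleton[OF finite_inversions])
qed

lemma coxeter_sign_comp: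
  assumes "u \<in> hyperoct n" "v \<in> hyperoct n"
  shows "coxeter_sign n (u \<circ> v) = coxeter_sign n u * coxeter_sign n v"
  using assms(1)
proof (induction u rule: hyperoct_induct)
  case id
  show ?case by (simp add: coxeter_sign_id del: id_apply)
next
  case (gen r u)
  then show ?case
    using hyperoct_comp[OF gen(2) assms(2)]
    by (simp only: comp_assoc coxeter_sign_gen_comp mult_minus_left)
qed

primrec coxeter_word :: "nat list \<Rightarrow> int \<Rightarrow> int" where
  "coxeter_word [] = id"
| "coxeter_word (r # rs) = coxeter_gen r \<circ> coxeter_word rs"

lemma foldr_coxeter_gen: "foldr (\<circ>) (map coxeter_gen rs) id = coxeter_word rs"
  by (induction rs) (simp_all only: list.map foldr.simps coxeter_word.simps comp_apply id_apply)

lemma ex_coxeter_word: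
  assumes "w \<in> hyperoct n"
  shows "\<exists>rs. set rs \<subseteq> {0..<n} \<and> w = coxeter_word rs"
  using assms
proof (induction w rule: hyperoct_induct)
  case id
  show ?case by (intro exI[of _ "[]"]) simp
next
  case (gen r w)
  then obtain rs where "set rs \<subseteq> {0..<n}" "w = coxeter_word rs" by blast
  then show ?case using gen(1) by (intro exI[of _ "r # rs"]) simp
qed

lemma coxeter_word_hyperoct: "set rs \<subseteq> {0..<n} \<Longrightarrow> coxeter_word rs \<in> hyperoct n"
  by (induction rs) (simp_all add: hyperoct_id hyperoct_comp coxeter_gen_hyperoct)

lemma coxeter_sign_coxeter_word:
  "set rs \<subseteq> {0..<n} \<Longrightarrow> coxeter_sign n (coxeter_word rs) = (- 1) ^ length rs"
  by (induction rs) (simp_all add: coxeter_sign_id coxeter_sign_gen_comp coxeter_word_hyperoct)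

lemma power_coxeter_length_eq_sign:
  assumes "w \<in> hyperoct n"
  shows "(- 1) ^ coxeter_length n w = coxeter_sign n w"
proof -
  have "\<exists>rs. length rs = coxeter_length n w \<and> set rs \<subseteq> {0..<n} \<and> w = coxeter_word rs"
    unfolding coxeter_length_def foldr_coxeter_gen
    by (rule LeastI_ex) (use ex_coxeter_word[OF assms] in blast)
  then show ?thesis using coxeter_sign_coxeter_word by metis
qed

lemma monom_1_add: "monom (1 :: 'a::comm_semiring_1) (a + b) = monom 1 a * monom 1 b"
  by (simp add: mult_monom)

definition weight :: "(int \<Rightarrow> int \<Rightarrow> bool) \<Rightarrow> nat \<Rightarrow> (int \<Rightarrow> int) \<Rightarrow> int poly" where
  "weight Q n w = coxeter_sign n w * monom 1 (card (inversions Q n w))"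

definition signed_sum :: "nat \<Rightarrow> nat set \<Rightarrow> int poly" where
  "signed_sum n I = (\<Sum>w\<in>hyperoct_desc n I. weight opposite_parity n w)"

lemma weight_id: "weight Q n id = 1"
  by (simp add: weight_def coxeter_sign_id inversions_id del: id_apply)

lemma signed_sum_eq:
  "signed_sum n I = (\<Sum>w\<in>hyperoct_desc n I. (- 1) ^ coxeter_length n w * monom 1 (odd_length n w))"
  unfolding signed_sum_def
  by (rule sum.cong)
     (simp_all add: hyperoct_descD weight_def power_coxeter_length_eq_sign
       odd_length_eq_card_inversions)

section \<open>Cancellation away from the parity-preserving permutations\<close>

definition evens :: "nat \<Rightarrow> int set" where
  "evens n = {i. \<bar>i\<bar> \<le> int n \<and> even i}"

lemma hyperoct_mem_image_evens:
  "w \<in> hyperoct n \<Longrightarrow> \<bar>i\<bar> \<le> int n \<Longrightarrow> w i \<in> w ` evens n \<longleftrightarrow> even i"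
  by (auto simp: evens_def hyperoct_eq_iff)

lemma hyperoct_image_evens_uminus:
  assumes w: "w \<in> hyperoct n"
  shows "- x \<in> w ` evens n \<longleftrightarrow> x \<in> w ` evens n"
proof -
  have "- x \<in> w ` evens n" if x: "x \<in> w ` evens n" for x
  proof -
    obtain i where "i \<in> evens n" "x = w i" using x by blast
    then have "- x = w (- i)" "- i \<in> evens n" by (simp_all add: hyperoct_minus[OF w] evens_def)
    then show ?thesis by blast
  qed
  from this[of x] this[of "- x"] show ?thesis by auto
qed

lemma alternating_symmetric_set_eq_evens:
  assumes "0 \<in> E" and sym: "\<And>x. - x \<in> E \<longleftrightarrow> x \<in> E" and bounded: "\<And>x. x \<in> E \<Longrightarrow> \<bar>x\<bar> \<le> int n"
    and alternating: "\<And>r. r < n \<Longrightarrow> int r \<in> E \<longleftrightarrow> int r + 1 \<notin> E"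
  shows "E = evens n"
proof -
  have nonneg: "int k \<in> E \<longleftrightarrow> even k" if "k \<le> n" for k
    using that
  proof (induction k)
    case 0
    then show ?case using \<open>0 \<in> E\<close> by simp
  next
    case (Suc k)
    then show ?case using alternating[of k] by (auto simp: add.commute)
  qed
  have "x \<in> E \<longleftrightarrow> even x" if "\<bar>x\<bar> \<le> int n" for x
  proof -
    have "x \<in> E \<longleftrightarrow> \<bar>x\<bar> \<in> E" using sym[of x] by (simp add: abs_if)
    also have "\<dots> \<longleftrightarrow> even x" using nonneg[of "nat \<bar>x\<bar>"] that by (simp add: even_nat_iff)
    finally show ?thesis .
  qed
  then show ?thesis using bounded by (auto simp: evens_def)
qed

lemma coxeter_gen_image_eq:
  assumes sym: "\<And>x. - x \<in> E \<longleftrightarrow> x \<in> E" and "int r \<in> E \<longleftrightarrow> int r + 1 \<in> E"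
  shows "coxeter_gen r ` E = E"
proof -
  have "coxeter_gen r x \<in> E" if "x \<in> E" for x
    using that assms(2) sym[of x] sym[of "int r"] sym[of "int r + 1"]
    by (auto simp: coxeter_gen_apply)
  moreover have "coxeter_gen r (coxeter_gen r x) = x" for x
    using coxeter_gen_involution[of r] by (metis comp_apply id_apply)
  ultimately show ?thesis by (metis image_eqI image_subsetI subset_antisym subsetI)
qed

lemma inversions_coxeter_gen_comp_same_parity:
  assumes w: "w \<in> hyperoct n" and r: "r < n"
    and same: "int r \<in> w ` evens n \<longleftrightarrow> int r + 1 \<in> w ` evens n"
  shows "inversions opposite_parity n (coxeter_gen r \<circ> w) = inversions opposite_parity n w"
proof -
  define E where "E = w ` evens n"
  obtain i j where ij: "\<bar>i\<bar> < j" "j \<le> int n" "adjacent_values r (w i) (w j)"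
    using ex_adjacent_values_position[OF w r] .
  have "- x \<in> E \<longleftrightarrow> x \<in> E" for x
    unfolding E_def by (rule hyperoct_image_evens_uminus[OF w])
  from this[of "int r"] this[of "int r + 1"] have "w i \<in> E \<longleftrightarrow> w j \<in> E"
    using ij(3) same[folded E_def] by (auto simp: adjacent_values_def)
  then have "even i \<longleftrightarrow> even j"
    using ij by (simp add: E_def hyperoct_mem_image_evens[OF w])
  then show ?thesis
    using inversions_coxeter_gen_comp[OF w ij, of opposite_parity]
    by (simp add: opposite_parity_def)
qed

lemma sum_weight_fibre_eq_0:
  assumes "E \<noteq> evens n"
  shows "(\<Sum>v | v \<in> hyperoct_desc n J \<and> v ` evens n = E. weight opposite_parity n v) = 0"
    (is "sum _ ?F = 0")
proof (cases "?F = {}")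
  case True
  then show ?thesis by (simp only: sum.empty)
next
  case False
  then obtain v where v: "v \<in> hyperoct n" "v ` evens n = E" by (blast dest: hyperoct_descD)
  have sym: "- x \<in> E \<longleftrightarrow> x \<in> E" for x
    using hyperoct_image_evens_uminus[OF v(1)] v(2) by blast
  have "0 \<in> E" using v hyperoct_zero[OF v(1)] by (force simp: evens_def)
  moreover have "\<bar>x\<bar> \<le> int n" if "x \<in> E" for x
    using that v hyperoct_abs_le[OF v(1)] by (auto simp: evens_def)
  ultimately obtain r where r: "r < n" and same: "int r \<in> E \<longleftrightarrow> int r + 1 \<in> E"
    using assms alternating_symmetric_set_eq_evens[of E n] sym by blast
  let ?s = "\<lambda>v. coxeter_gen r \<circ> v"
  show ?thesis
  proof (rule sum_involution_eq_0)
    fix v assume v: "v \<in> ?F"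
    then have hyp: "v \<in> hyperoct n" by (blast dest: hyperoct_descD)
    have inv: "inversions opposite_parity n (?s v) = inversions opposite_parity n v"
      using v same by (intro inversions_coxeter_gen_comp_same_parity hyp r) auto
    show "weight opposite_parity n (?s v) + weight opposite_parity n v = 0"
      by (simp only: weight_def inv coxeter_sign_gen_comp[OF hyp r] mult_minus_left
          add.left_inverse)
    have "?s v ` evens n = E"
      using v coxeter_gen_image_eq[OF sym same] by (simp only: image_comp[symmetric] mem_Collect_eq)
    moreover have "?s v \<in> hyperoct_desc n J"
      using v inv hyperoct_comp[OF coxeter_gen_hyperoct[OF r] hyp]
      by (simp only: hyperoct_desc_def descents_eq_inversions mem_Collect_eq)
    ultimately show "?s v \<in> ?F" by blast
    have "coxeter_gen r (int r + 1) \<noteq> int r + 1" by (simp add: coxeter_gen_apply)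
    then show "?s v \<noteq> v" by (metis comp_apply hyperoct_apply_inv[OF hyp])
    show "?s (?s v) = v" by (rule coxeter_gen_involutory)
  qed
qed

lemma sum_eq_if_other_fibres_vanish:
  fixes f :: "'a \<Rightarrow> 'c::comm_semiring_0"
  assumes "finite A" and vanish: "\<And>e. e \<noteq> e\<^sub>0 \<Longrightarrow> (\<Sum>x | x \<in> A \<and> h x = e. f x) = 0"
  shows "(\<Sum>x\<in>A. f x * G (h x)) = (\<Sum>x\<in>A. f x) * G e\<^sub>0"
proof -
  have "(\<Sum>x\<in>A. f x * G (h x)) = (\<Sum>e\<in>h ` A. \<Sum>x | x \<in> A \<and> h x = e. f x * G (h x))"
    by (rule sum.image_gen[OF \<open>finite A\<close>])
  also have "\<dots> = (\<Sum>e\<in>h ` A. (\<Sum>x | x \<in> A \<and> h x = e. f x) * G e)"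
    by (simp add: sum_distrib_right)
  also have "\<dots> = (\<Sum>e\<in>h ` A. (\<Sum>x | x \<in> A \<and> h x = e. f x) * G e\<^sub>0)"
  proof (rule sum.cong[OF refl])
    fix e show "(\<Sum>x | x \<in> A \<and> h x = e. f x) * G e = (\<Sum>x | x \<in> A \<and> h x = e. f x) * G e\<^sub>0"
      using vanish[of e] by (cases "e = e\<^sub>0") simp_all
  qed
  also have "\<dots> = (\<Sum>x\<in>A. f x) * G e\<^sub>0"
    by (simp only: sum_distrib_right[symmetric] sum.image_gen[OF \<open>finite A\<close>, of f h, symmetric])
  finally show ?thesis .
qed

lemma sum_weight_image_evens:
  "(\<Sum>v\<in>hyperoct_desc n J. weight opposite_parity n v * G (v ` evens n)) =
     signed_sum n J * G (evens n)"
  unfolding signed_sum_def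
  by (rule sum_eq_if_other_fibres_vanish[OF finite_hyperoct_desc sum_weight_fibre_eq_0])

section \<open>Factorization at the last descent\<close>

text \<open>In \<open>cross_inversions E m n u\<close> the set \<open>E\<close> takes the role of the even positions in \<open>{- m..m}\<close>.\<close>
definition cross_inversions :: "int set \<Rightarrow> nat \<Rightarrow> nat \<Rightarrow> (int \<Rightarrow> int) \<Rightarrow> (int \<times> int) set" where
  "cross_inversions E m n u =
     {(i, j). \<bar>i\<bar> \<le> int m \<and> int m < j \<and> j \<le> int n \<and> (i \<in> E \<longleftrightarrow> odd j) \<and> u j < u i}"

definition outer_inversions :: "nat \<Rightarrow> nat \<Rightarrow> (int \<Rightarrow> int) \<Rightarrow> (int \<times> int) set" where
  "outer_inversions m n u = {(i, j) \<in> inversions opposite_parity n u. int m < \<bar>i\<bar>}"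

lemma finite_cross_inversions: "finite (cross_inversions E m n u)"
  by (rule finite_subset[of _ "{- int m..int m} \<times> {- int n..int n}"])
     (auto simp: cross_inversions_def)

lemma card_inversions_split:
  assumes "m \<le> n"
  shows "card (inversions opposite_parity n u) = card (inversions opposite_parity m u) +
    card (cross_inversions (evens m) m n u) + card (outer_inversions m n u)"
proof -
  let ?A = "inversions opposite_parity m u" and ?B = "cross_inversions (evens m) m n u"
    and ?C = "outer_inversions m n u"
  have "p \<in> inversions opposite_parity n u \<longleftrightarrow> p \<in> ?A \<union> ?B \<union> ?C" for p
  proof -
    obtain i j where p: "p = (i, j)" by (cases p)
    consider "\<bar>i\<bar> \<le> int m" "j \<le> int m" | "\<bar>i\<bar> \<le> int m" "int m < j" | "int m < \<bar>i\<bar>" by linarith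
    then show ?thesis
    proof cases
      case 2
      then have "opposite_parity \<bar>i\<bar> j \<longleftrightarrow> (i \<in> evens m \<longleftrightarrow> odd j)"
        by (simp add: opposite_parity_def evens_def)
      then show ?thesis
        using 2 by (simp add: p inversions_def cross_inversions_def outer_inversions_def)
    qed (use \<open>m \<le> n\<close> in \<open>auto simp: p inversions_def cross_inversions_def outer_inversions_def\<close>)
  qed
  then have "inversions opposite_parity n u = ?A \<union> ?B \<union> ?C" by blast
  moreover have "finite ?C"
    by (rule finite_subset[OF _ finite_inversions[of opposite_parity n u]])
       (auto simp: outer_inversions_def)
  moreover have "(?A \<union> ?B) \<inter> ?C = {}" "?A \<inter> ?B = {}"
    by (auto simp: inversions_def cross_inversions_def outer_inversions_def)
  ultimately show ?thesis
    by (simp add: card_Un_disjoint finite_inversions finite_cross_inversions)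
qed

lemma inversions_comp_strict_mono:
  assumes mono: "strict_mono_on {- int m..int m} u" and v: "v \<in> hyperoct m"
  shows "inversions Q m (u \<circ> v) = inversions Q m v"
proof -
  have "u (v j) < u (v i) \<longleftrightarrow> v j < v i" if "\<bar>i\<bar> < j" "j \<le> int m" for i j
  proof -
    have "i \<in> {- int m..int m}" "j \<in> {- int m..int m}" using that by auto
    then show ?thesis
      using same_order_on_strict_mono_comp[OF mono hyperoct_permutes[OF v]]
      by (auto simp: same_order_on_def)
  qed
  then show ?thesis by (auto simp: inversions_def)
qed

lemma card_cross_inversions_comp:
  assumes v: "v \<in> hyperoct m"
  shows "card (cross_inversions E m n (u \<circ> v)) = card (cross_inversions (v ` E) m n u)"
proof -
  let ?f = "\<lambda>(i, j). (v i, j)" and ?g = "\<lambda>(i, j). (inv v i, j)"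
  have mem: "v i \<in> v ` E \<longleftrightarrow> i \<in> E" for i
    by (auto simp: hyperoct_eq_iff[OF v])
  have "v j = j" if "int m < j" for j
    using hyperoct_fixed[OF v] that by simp
  then have apply_mem:
    "(v i, j) \<in> cross_inversions (v ` E) m n u \<longleftrightarrow> (i, j) \<in> cross_inversions E m n (u \<circ> v)" for i j
    by (auto simp: cross_inversions_def mem hyperoct_abs_le[OF v])
  have inv_mem: "(inv v i, j) \<in> cross_inversions E m n (u \<circ> v)"
    if "(i, j) \<in> cross_inversions (v ` E) m n u" for i j
    using apply_mem[of "inv v i" j] that by (simp only: hyperoct_apply_inv[OF v])
  have "bij_betw ?f (cross_inversions E m n (u \<circ> v)) (cross_inversions (v ` E) m n u)"
    by (rule bij_betw_byWitness[where f' = ?g])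
       (use apply_mem inv_mem in \<open>auto simp: hyperoct_inv_apply[OF v] hyperoct_apply_inv[OF v]\<close>)
  then show ?thesis by (rule bij_betw_same_card)
qed

lemma outer_inversions_comp:
  assumes v: "v \<in> hyperoct m"
  shows "outer_inversions m n (u \<circ> v) = outer_inversions m n u"
proof -
  have "v i = i" if "int m < \<bar>i\<bar>" for i
    using hyperoct_fixed[OF v that] .
  then show ?thesis by (auto simp: outer_inversions_def inversions_def)
qed

definition coset_weight :: "nat \<Rightarrow> nat \<Rightarrow> (int \<Rightarrow> int) \<Rightarrow> int set \<Rightarrow> int poly" where
  "coset_weight m n u E =
     coxeter_sign n u * monom 1 (card (cross_inversions E m n u) + card (outer_inversions m n u))"

lemma weight_comp:
  assumes u: "u \<in> hyperoct_desc n {m}" and v: "v \<in> hyperoct m" and "m \<le> n"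
  shows "weight opposite_parity n (u \<circ> v) =
    weight opposite_parity m v * coset_weight m n u (v ` evens m)"
proof -
  have "descents n u \<subseteq> {m}" using u by (simp add: hyperoct_desc_def)
  then have mono: "strict_mono_on {- int m..int m} u"
    using strict_mono_on_iff_no_descents[OF hyperoct_descD[OF u] \<open>m \<le> n\<close>] by auto
  have "card (inversions opposite_parity n (u \<circ> v)) = card (inversions opposite_parity m v) +
      (card (cross_inversions (v ` evens m) m n u) + card (outer_inversions m n u))"
    by (simp add: card_inversions_split[OF \<open>m \<le> n\<close>] inversions_comp_strict_mono[OF mono v]
        card_cross_inversions_comp[OF v] outer_inversions_comp[OF v] del: comp_apply)
  moreover have "coxeter_sign n (u \<circ> v) = (coxeter_sign m v * coxeter_sign n u :: int poly)"
    by (simp only: coxeter_sign_comp[OF hyperoct_descD[OF u] hyperoct_mono[OF \<open>m \<le> n\<close> v]]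
        coxeter_sign_mono[OF v \<open>m \<le> n\<close>] mult.commute)
  ultimately show ?thesis by (simp only: weight_def coset_weight_def monom_1_add mult_ac)
qed

lemma coset_weight_evens:
  assumes "u \<in> hyperoct_desc n {m}" "m \<le> n"
  shows "coset_weight m n u (evens m) = weight opposite_parity n u"
  using weight_comp[OF assms(1) hyperoct_id assms(2)]
  by (simp only: weight_id comp_id image_id id_apply mult_1)

lemma signed_sum_insert:
  assumes "m < n" and "J \<subseteq> {..<m}"
  shows "signed_sum n (insert m J) = signed_sum n {m} * signed_sum m J"
proof -
  let ?wt = "weight opposite_parity"
  have "signed_sum n (insert m J) =
      (\<Sum>(u, v)\<in>hyperoct_desc n {m} \<times> hyperoct_desc m J. ?wt n (u \<circ> v))"
    unfolding signed_sum_def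
    by (subst sum.reindex_bij_betw[OF hyperoct_desc_factorization_bij[OF assms], symmetric])
       (simp only: case_prod_unfold)
  also have "\<dots> = (\<Sum>u\<in>hyperoct_desc n {m}. \<Sum>v\<in>hyperoct_desc m J. ?wt n (u \<circ> v))"
    by (rule sum.cartesian_product[symmetric])
  also have "\<dots> = (\<Sum>u\<in>hyperoct_desc n {m}. ?wt n u * signed_sum m J)"
  proof (rule sum.cong[OF refl])
    fix u assume u: "u \<in> hyperoct_desc n {m}"
    have "(\<Sum>v\<in>hyperoct_desc m J. ?wt n (u \<circ> v)) =
        (\<Sum>v\<in>hyperoct_desc m J. ?wt m v * coset_weight m n u (v ` evens m))"
      by (rule sum.cong[OF refl]) (rule weight_comp[OF u hyperoct_descD less_imp_le[OF \<open>m < n\<close>]])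
    also have "\<dots> = ?wt n u * signed_sum m J"
      using coset_weight_evens[OF u] \<open>m < n\<close>
      by (simp only: sum_weight_image_evens less_imp_le mult.commute)
    finally show "(\<Sum>v\<in>hyperoct_desc m J. ?wt n (u \<circ> v)) = ?wt n u * signed_sum m J" .
  qed
  also have "\<dots> = signed_sum n {m} * signed_sum m J"
    by (simp only: signed_sum_def sum_distrib_right)
  finally show ?thesis .
qed

section \<open>Inserting the extreme value\<close>

definition skip :: "nat \<Rightarrow> int \<Rightarrow> int" where
  "skip p i = (if \<bar>i\<bar> < int p then i else i + sgn i)"

text \<open>
  \<open>u \<circ> insertion N p s\<close> is obtained from \<open>u \<in> hyperoct N\<close> by inserting the value \<open>s * (N + 1)\<close>
  at position \<open>p\<close>.
\<close>
definition insertion :: "nat \<Rightarrow> nat \<Rightarrow> int \<Rightarrow> int \<Rightarrow> int" where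
  "insertion N p s i =
     (if \<bar>i\<bar> = int p then sgn i * s * (int N + 1)
      else if int p < \<bar>i\<bar> \<and> \<bar>i\<bar> \<le> int N + 1 then i - sgn i else i)"

lemma abs_skip: "1 \<le> p \<Longrightarrow> \<bar>skip p i\<bar> = skip p \<bar>i\<bar>"
  by (auto simp: skip_def sgn_if)

lemma skip_less_iff: "1 \<le> p \<Longrightarrow> 0 \<le> i \<Longrightarrow> skip p i < skip p j \<longleftrightarrow> i < j"
  by (auto simp: skip_def sgn_if)

lemma skip_eq_iff: "1 \<le> p \<Longrightarrow> skip p i = skip p j \<longleftrightarrow> i = j"
  by (auto simp: skip_def sgn_if split: if_splits)

lemma skip_le_Suc_iff: "p \<le> Suc N \<Longrightarrow> skip p i \<le> int N + 1 \<longleftrightarrow> i \<le> int N"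
  by (auto simp: skip_def sgn_if)

lemma abs_skip_neq: "1 \<le> p \<Longrightarrow> \<bar>skip p i\<bar> \<noteq> int p"
  by (auto simp: skip_def sgn_if)

lemma ex_skip_eq:
  assumes "1 \<le> p" "\<bar>i\<bar> \<noteq> int p"
  obtains k where "i = skip p k"
proof
  show "i = skip p (if \<bar>i\<bar> < int p then i else i - sgn i)"
    using assms by (auto simp: skip_def sgn_if)
qed

lemma insertion_skip: "1 \<le> p \<Longrightarrow> \<bar>i\<bar> \<le> int N \<Longrightarrow> insertion N p s (skip p i) = i"
  by (cases i "0 :: int" rule: linorder_cases) (auto simp: insertion_def skip_def)

lemma insertion_position: "1 \<le> p \<Longrightarrow> insertion N p s (int p) = s * (int N + 1)"
  by (simp add: insertion_def)

lemma insertion_last: "insertion N (Suc N) 1 = id"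
  by (auto simp: fun_eq_iff insertion_def sgn_if)

lemma insertion_hyperoct:
  assumes p: "p \<in> {1..Suc N}" and s: "s \<in> {1, - 1}"
  shows "insertion N p s \<in> hyperoct (Suc N)"
proof (rule hyperoctI)
  let ?f = "insertion N p s" and ?S = "{- int (Suc N)..int (Suc N)}"
  show minus: "?f (- i) = - ?f i" for i
    by (simp add: insertion_def)
  have surj: "x \<in> ?f ` ?S" if "x \<in> ?S" for x
  proof (cases "\<bar>x\<bar> \<le> int N")
    case True
    moreover have "skip p x \<in> ?S" using True by (auto simp: skip_def sgn_if)
    ultimately show ?thesis
      using p insertion_skip[of p x N s] by (metis atLeastAtMost_iff image_eqI)
  next
    case False
    then have "x = int N + 1 \<or> x = - (int N + 1)" using that by auto
    then have "x = ?f (int p) \<or> x = ?f (- int p)"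
      using p s minus[of "int p"] insertion_position[of p N s] by auto
    then show ?thesis using p by auto
  qed
  have "card (?f ` ?S) \<le> card ?S" by (rule card_image_le) simp
  then have "?S = ?f ` ?S" using surj by (intro card_seteq) auto
  moreover from this have "inj_on ?f ?S" by (intro eq_card_imp_inj_on) auto
  ultimately have "bij_betw ?f ?S ?S" by (simp add: bij_betw_def)
  then show "?f permutes ?S"
    by (rule bij_imp_permutes) (use p in \<open>auto simp: insertion_def\<close>)
qed

lemma hyperoct_if_fixes_last:
  assumes w: "w \<in> hyperoct (Suc N)" and "w (int N + 1) = int N + 1"
  shows "w \<in> hyperoct N"
proof (rule hyperoctI)
  show "w (- i) = - w i" for i by (rule hyperoct_minus[OF w])
  show "w permutes {- int N..int N}"
  proof (rule permutes_superset[OF hyperoct_permutes[OF w]])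
    fix x assume "x \<in> {- int (Suc N)..int (Suc N)} - {- int N..int N}"
    then have "x = int N + 1 \<or> x = - (int N + 1)" by auto
    then show "w x = x" using assms(2) hyperoct_minus[OF w, of "int N + 1"] by auto
  qed
qed

lemma comp_insertion_position:
  assumes u: "u \<in> hyperoct N" and p: "p \<in> {1..Suc N}" and s: "s \<in> {1, - 1}"
  shows "(u \<circ> insertion N p s) (int p) = s * (int N + 1)"
  using p s hyperoct_fixed[OF u, of "int N + 1"] hyperoct_minus[OF u, of "int N + 1"]
  by (auto simp: insertion_position)

lemma comp_insertion_hyperoct:
  assumes "u \<in> hyperoct N" "p \<in> {1..Suc N}" "s \<in> {1, - 1}"
  shows "u \<circ> insertion N p s \<in> hyperoct (Suc N)"
  using assms by (intro hyperoct_comp insertion_hyperoct hyperoct_mono[of N "Suc N"]) auto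

lemma comp_insertion_eqD:
  assumes u: "u \<in> hyperoct N" and p: "p \<in> {1..Suc N}" and s: "s \<in> {1, - 1}"
    and u': "u' \<in> hyperoct N" and p': "p' \<in> {1..Suc N}" and s': "s' \<in> {1, - 1}"
    and eq: "u \<circ> insertion N p s = u' \<circ> insertion N p' s'"
  shows "(u, p, s) = (u', p', s')"
proof -
  let ?w = "u \<circ> insertion N p s"
  have w: "?w \<in> hyperoct (Suc N)" by (rule comp_insertion_hyperoct[OF u p s])
  have w_p: "?w (int p) = s * (int N + 1)" and w_p': "?w (int p') = s' * (int N + 1)"
    using comp_insertion_position[OF u p s] comp_insertion_position[OF u' p' s']
    by (simp_all only: eq)
  have "\<bar>?w (int p)\<bar> = \<bar>?w (int p')\<bar>"
    unfolding w_p w_p' using s s' by auto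
  then have "p = p'" using hyperoct_abs_eq_iff[OF w, of "int p" "int p'"] by simp
  moreover from this have "s = s'" using w_p w_p' by simp
  moreover from calculation have "u = u'"
    using eq hyperoct_comp_inv(1)[OF insertion_hyperoct[OF p s]] by (metis comp_assoc comp_id)
  ultimately show ?thesis by simp
qed

lemma ex_comp_insertion:
  assumes w: "w \<in> hyperoct (Suc N)"
  obtains u p s where "u \<in> hyperoct N" "p \<in> {1..Suc N}" "s \<in> {1, - 1}" "w = u \<circ> insertion N p s"
proof -
  define q where "q = inv w (int N + 1)"
  have w_q: "w q = int N + 1" by (simp add: q_def hyperoct_apply_inv[OF w])
  define p s where "p = nat \<bar>q\<bar>" and "s = sgn q"
  have "q \<noteq> 0" using w_q hyperoct_zero[OF w] by auto
  moreover have "\<bar>q\<bar> \<le> int N + 1" using w_q hyperoct_abs_le[OF w, of q] by simp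
  ultimately have p: "p \<in> {1..Suc N}" and s: "s \<in> {1, - 1}" by (auto simp: p_def s_def sgn_if)
  let ?f = "insertion N p s" and ?u = "w \<circ> inv (insertion N p s)"
  note f = insertion_hyperoct[OF p s]
  have "?f q = int N + 1"
    using \<open>q \<noteq> 0\<close> by (auto simp: insertion_def p_def s_def sgn_if)
  then have "?u (int N + 1) = int N + 1"
    using w_q hyperoct_inv_apply[OF f, of q] by simp
  moreover have "?u \<in> hyperoct (Suc N)" by (intro hyperoct_comp hyperoct_inv w f)
  ultimately have u: "?u \<in> hyperoct N" by (rule hyperoct_if_fixes_last[rotated])
  have eq: "w = ?u \<circ> ?f" by (simp add: comp_assoc hyperoct_comp_inv(2)[OF f])
  show ?thesis by (rule that[OF u p s eq])
qed

lemma hyperoct_Suc_bij: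
  "bij_betw (\<lambda>(u, p, s). u \<circ> insertion N p s)
     (hyperoct N \<times> {1..Suc N} \<times> {1, - 1}) (hyperoct (Suc N))"
    (is "bij_betw ?f ?A _")
  unfolding bij_betw_def
proof
  show "inj_on ?f ?A"
  proof (rule inj_onI)
    fix x x' assume x: "x \<in> ?A" "x' \<in> ?A" "?f x = ?f x'"
    obtain u p s where x_eq: "x = (u, p, s)" by (cases x)
    obtain u' p' s' where x'_eq: "x' = (u', p', s')" by (cases x')
    show "x = x'"
      unfolding x_eq x'_eq by (rule comp_insertion_eqD) (use x in \<open>simp_all add: x_eq x'_eq\<close>)
  qed
  show "?f ` ?A = hyperoct (Suc N)"
  proof (intro subset_antisym subsetI)
    fix w assume w: "w \<in> hyperoct (Suc N)"
    obtain u p s where "u \<in> hyperoct N" "p \<in> {1..Suc N}" "s \<in> {1, - 1}" "w = u \<circ> insertion N p s"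
      using ex_comp_insertion[OF w] .
    then show "w \<in> ?f ` ?A" by (intro rev_image_eqI[of "(u, p, s)"]) simp_all
  next
    fix w assume "w \<in> ?f ` ?A"
    then obtain x where x: "x \<in> ?A" "w = ?f x" by blast
    obtain u p s where "x = (u, p, s)" by (cases x)
    then show "w \<in> hyperoct (Suc N)" using x comp_insertion_hyperoct[of u N p s] by simp
  qed
qed

context
  fixes N p :: nat and s :: int and u :: "int \<Rightarrow> int"
  assumes u: "u \<in> hyperoct N" and p: "p \<in> {1..Suc N}" and s: "s \<in> {1, - 1}"
begin

lemma comp_insertion_skip: "\<bar>i\<bar> \<le> int N \<Longrightarrow> (u \<circ> insertion N p s) (skip p i) = u i"
  using p by (simp add: insertion_skip)

lemma comp_insertion_skip_less: "\<bar>i\<bar> \<le> int N \<Longrightarrow> \<bar>(u \<circ> insertion N p s) (skip p i)\<bar> < int N + 1"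
  using hyperoct_abs_le[OF u, of i] by (simp add: comp_insertion_skip del: comp_apply)

lemma descents_comp_insertion:
  "descents (Suc N) (u \<circ> insertion N p s) =
     {i \<in> descents N u. Suc i < p} \<union> Suc ` {i \<in> descents N u. p \<le> i} \<union>
     (if s = 1 then {p} \<inter> {..N} else {p - 1})" (is "_ = ?D")
proof -
  let ?w = "u \<circ> insertion N p s"
  have low: "?w (int i) = u (int i)" if "i < p" for i
    using comp_insertion_skip[of "int i"] that p by (simp add: skip_def del: comp_apply)
  have high: "?w (int i + 1) = u (int i)" if "p \<le> i" "i \<le> N" for i
    using comp_insertion_skip[of "int i"] that p by (simp add: skip_def del: comp_apply)
  have pos: "?w (int p) = s * (int N + 1)" by (rule comp_insertion_position[OF u p s])
  have bound: "\<bar>u (int i)\<bar> < int N + 1" if "i \<le> N" for i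
    using hyperoct_abs_le[OF u, of "int i"] that by simp
  have "i \<in> descents (Suc N) ?w \<longleftrightarrow> i \<in> ?D" if "i < Suc N" for i
  proof -
    consider "Suc i < p" | "Suc i = p" | "i = p" | "p < i" by linarith
    then show ?thesis
    proof cases
      case 1
      then have "?w (int i + 1) = u (int i + 1)" using low[of "Suc i"] by (simp add: add.commute)
      then show ?thesis using 1 low[of i] p by (auto simp: descents_def simp del: comp_apply)
    next
      case 2
      then have "int i + 1 = int p" by simp
      then have "?w (int i + 1) = s * (int N + 1)" by (simp only: pos)
      then show ?thesis
        using 2 low[of i] bound[of i] s that by (auto simp: descents_def simp del: comp_apply)
    next
      case 3
      then show ?thesis
        using pos high[of i] bound[of i] p s that by (auto simp: descents_def simp del: comp_apply)
    next
      case 4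
      then obtain j where j: "i = Suc j" "p \<le> j" by (cases i) auto
      then have "?w (int i) = u (int j)" "?w (int i + 1) = u (int j + 1)"
        using high[of j] high[of i] that by (simp_all add: add.commute del: comp_apply)
      then show ?thesis using j s that by (auto simp: descents_def simp del: comp_apply)
    qed
  qed
  moreover have "?D \<subseteq> {..<Suc N}" using p by (auto simp: descents_def)
  moreover have "descents (Suc N) ?w \<subseteq> {..<Suc N}" by (auto simp: descents_def)
  ultimately show ?thesis by blast
qed

lemma comp_insertion_hyperoct_desc_iff:
  assumes "m \<le> N"
  shows "u \<circ> insertion N p s \<in> hyperoct_desc (Suc N) {m} \<longleftrightarrow>
    (p, s) = (Suc N, 1) \<and> u \<in> hyperoct_desc N {m} \<or>
    (p, s) = (m, 1) \<and> u \<in> hyperoct_desc N {m - 1} \<or>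
    (p, s) = (Suc m, - 1) \<and> u \<in> hyperoct_desc N {m}"
proof -
  have desc_less: "i < N" if "i \<in> descents N u" for i using that by (simp add: descents_def)
  have hyp: "u \<circ> insertion N p s \<in> hyperoct (Suc N)" by (rule comp_insertion_hyperoct[OF u p s])
  define rest where "rest = {i \<in> descents N u. Suc i < p} \<union> Suc ` {i \<in> descents N u. p \<le> i}"
  have rest: "rest \<subseteq> {k} \<longleftrightarrow> descents N u \<subseteq> {p - 1}" if "k = p \<or> k = p - 1" for k
  proof -
    have "(Suc i < p \<longrightarrow> i = k) \<and> (p \<le> i \<longrightarrow> Suc i = k) \<longleftrightarrow> i = p - 1" for i
      using that p by auto
    then show ?thesis unfolding rest_def by blast
  qed
  consider "s = 1" "p = Suc N" | "s = 1" "p \<le> N" | "s = - 1" using s p by force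
  then show ?thesis
  proof cases
    case 1
    then have "descents (Suc N) (u \<circ> insertion N p s) = descents N u"
      unfolding descents_comp_insertion by (auto dest: desc_less)
    then show ?thesis using 1 hyp u \<open>m \<le> N\<close> by (auto simp: hyperoct_desc_def)
  next
    case 2
    then have "descents (Suc N) (u \<circ> insertion N p s) = insert p rest"
      unfolding descents_comp_insertion rest_def by auto
    then show ?thesis using 2 hyp u rest[of p] by (auto simp: hyperoct_desc_def)
  next
    case 3
    then have "descents (Suc N) (u \<circ> insertion N p s) = insert (p - 1) rest"
      unfolding descents_comp_insertion rest_def by auto
    then show ?thesis using 3 hyp u p rest[of "p - 1"] by (auto simp: hyperoct_desc_def)
  qed
qed

lemma mem_inversions_comp_insertion_skip:
  "(skip p i, skip p j) \<in> inversions Q (Suc N) (u \<circ> insertion N p s) \<longleftrightarrow>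
     (i, j) \<in> inversions (\<lambda>a b. Q (skip p a) (skip p b)) N u"
proof -
  have "1 \<le> p" "p \<le> Suc N" using p by auto
  then show ?thesis
    using skip_le_Suc_iff[of p N j] skip_less_iff[of p "\<bar>i\<bar>" j]
      comp_insertion_skip[of i] comp_insertion_skip[of j]
    by (auto simp: inversions_def abs_skip simp del: comp_apply)
qed

lemma mem_inversions_comp_insertion_right:
  assumes "\<bar>i\<bar> < int p"
  shows "(i, int p) \<in> inversions Q (Suc N) (u \<circ> insertion N p s) \<longleftrightarrow> s = - 1 \<and> Q \<bar>i\<bar> (int p)"
proof -
  have "\<bar>(u \<circ> insertion N p s) i\<bar> < int N + 1"
    using comp_insertion_skip_less[of i] assms p by (simp add: skip_def del: comp_apply)
  then show ?thesis
    using assms s p comp_insertion_position[OF u p s]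
    by (auto simp: inversions_def simp del: comp_apply)
qed

lemma mem_inversions_comp_insertion_left:
  assumes "\<bar>i\<bar> = int p"
  shows "(i, j) \<in> inversions Q (Suc N) (u \<circ> insertion N p s) \<longleftrightarrow>
    i = s * int p \<and> j \<in> {int p<..int N + 1} \<and> Q (int p) j"
proof (cases "j \<in> {int p<..int N + 1}")
  case True
  let ?w = "u \<circ> insertion N p s"
  have "skip p (j - 1) = j" using True p by (auto simp: skip_def sgn_if)
  then have "\<bar>?w j\<bar> < int N + 1"
    using comp_insertion_skip_less[of "j - 1"] True p by (simp del: comp_apply)
  moreover have "?w (s * int p) = int N + 1" "?w (- (s * int p)) = - (int N + 1)"
    using s comp_insertion_position[OF u p s]
      hyperoct_minus[OF comp_insertion_hyperoct[OF u p s], of "int p"] by auto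
  moreover have "i = s * int p \<or> i = - (s * int p)" and "s * int p \<noteq> 0"
    using assms s p by auto
  ultimately have "?w j < ?w i \<longleftrightarrow> i = s * int p"
    by (elim disjE) (simp_all del: comp_apply)
  then show ?thesis
    using True assms by (auto simp: inversions_def simp del: comp_apply)
next
  case False
  then show ?thesis using assms by (auto simp: inversions_def)
qed

lemma inversions_comp_insertion:
  "inversions Q (Suc N) (u \<circ> insertion N p s) =
     map_prod (skip p) (skip p) ` inversions (\<lambda>a b. Q (skip p a) (skip p b)) N u \<union>
     (\<lambda>i. (i, int p)) ` {i. \<bar>i\<bar> < int p \<and> s = - 1 \<and> Q \<bar>i\<bar> (int p)} \<union>
     Pair (s * int p) ` {j \<in> {int p<..int N + 1}. Q (int p) j}" (is "?I = ?X \<union> ?Y \<union> ?Z")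
proof (intro subset_antisym subsetI)
  fix x assume x: "x \<in> ?I"
  obtain i j where ij: "x = (i, j)" by (cases x)
  then have "\<bar>i\<bar> < j" using x by (simp add: inversions_def)
  consider "\<bar>i\<bar> = int p" | "j = int p" | "\<bar>i\<bar> \<noteq> int p" "\<bar>j\<bar> \<noteq> int p" using \<open>\<bar>i\<bar> < j\<close> by linarith
  then show "x \<in> ?X \<union> ?Y \<union> ?Z"
  proof cases
    case 1
    then show ?thesis using x mem_inversions_comp_insertion_left by (auto simp: ij)
  next
    case 2
    then show ?thesis using x \<open>\<bar>i\<bar> < j\<close> mem_inversions_comp_insertion_right by (auto simp: ij)
  next
    case 3
    then obtain k l where "i = skip p k" "j = skip p l"
      using ex_skip_eq[of p] p by (metis atLeastAtMost_iff)
    then have "x \<in> ?X" using x mem_inversions_comp_insertion_skip by (force simp: ij)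
    then show ?thesis by blast
  qed
next
  fix x assume "x \<in> ?X \<union> ?Y \<union> ?Z"
  then consider i j where "x = (skip p i, skip p j)"
      "(i, j) \<in> inversions (\<lambda>a b. Q (skip p a) (skip p b)) N u"
    | i where "x = (i, int p)" "\<bar>i\<bar> < int p" "s = - 1" "Q \<bar>i\<bar> (int p)"
    | j where "x = (s * int p, j)" "j \<in> {int p<..int N + 1}" "Q (int p) j"
    by auto
  then show "x \<in> ?I"
  proof cases
    case 1
    then show ?thesis by (simp only: mem_inversions_comp_insertion_skip)
  next
    case 2
    then show ?thesis using mem_inversions_comp_insertion_right[OF 2(2)] by blast
  next
    case 3
    moreover have "\<bar>s * int p\<bar> = int p" using s by auto
    ultimately show ?thesis using mem_inversions_comp_insertion_left[of "s * int p"] by blast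
  qed
qed

lemma card_inversions_comp_insertion:
  "card (inversions Q (Suc N) (u \<circ> insertion N p s)) =
     card (inversions (\<lambda>a b. Q (skip p a) (skip p b)) N u) +
     (if s = 1 then 0 else card {i. \<bar>i\<bar> < int p \<and> Q \<bar>i\<bar> (int p)}) +
     card {j \<in> {int p<..int N + 1}. Q (int p) j}"
proof -
  let ?X = "map_prod (skip p) (skip p) ` inversions (\<lambda>a b. Q (skip p a) (skip p b)) N u"
  let ?Y = "(\<lambda>i. (i, int p)) ` {i. \<bar>i\<bar> < int p \<and> s = - 1 \<and> Q \<bar>i\<bar> (int p)}"
  let ?Z = "Pair (s * int p) ` {j \<in> {int p<..int N + 1}. Q (int p) j}"
  have "1 \<le> p" using p by simp
  have "card ?X = card (inversions (\<lambda>a b. Q (skip p a) (skip p b)) N u)"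
    by (rule card_image) (auto simp: inj_on_def skip_eq_iff[OF \<open>1 \<le> p\<close>])
  moreover have "card ?Y = (if s = 1 then 0 else card {i. \<bar>i\<bar> < int p \<and> Q \<bar>i\<bar> (int p)})"
    using s by (auto simp: card_image inj_on_def)
  moreover have "card ?Z = card {j \<in> {int p<..int N + 1}. Q (int p) j}"
    by (simp add: card_image inj_on_def)
  moreover have "finite (?X \<union> ?Y \<union> ?Z)"
    unfolding inversions_comp_insertion[symmetric] by (rule finite_inversions)
  moreover have "skip p k \<noteq> int p" "int p \<noteq> skip p k" "s * int p \<noteq> skip p k" for k
    using abs_skip_neq[OF \<open>1 \<le> p\<close>, of k] s by auto
  then have "?X \<inter> ?Y = {}" "(?X \<union> ?Y) \<inter> ?Z = {}"
    using s by auto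
  ultimately show ?thesis
    by (simp only: inversions_comp_insertion card_Un_disjoint finite_Un)
qed

end

lemma hyperoct_desc_Suc_bij:
  assumes "m \<le> N"
  shows "bij_betw (\<lambda>(u, p, s). u \<circ> insertion N p s)
    (hyperoct_desc N {m} \<times> {(Suc N, 1)} \<union>
     (if m = 0 then {} else hyperoct_desc N {m - 1} \<times> {(m, 1)}) \<union>
     hyperoct_desc N {m} \<times> {(Suc m, - 1)})
    (hyperoct_desc (Suc N) {m})" (is "bij_betw ?f ?T _")
proof -
  let ?A = "hyperoct N \<times> {1..Suc N} \<times> {1, - 1}"
  have "bij_betw ?f {x \<in> ?A. ?f x \<in> hyperoct_desc (Suc N) {m}}
      {w \<in> hyperoct (Suc N). w \<in> hyperoct_desc (Suc N) {m}}"
    by (rule bij_betw_Collect[OF hyperoct_Suc_bij]) auto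
  moreover have "{w \<in> hyperoct (Suc N). w \<in> hyperoct_desc (Suc N) {m}} = hyperoct_desc (Suc N) {m}"
    by (auto dest: hyperoct_descD)
  moreover have "{x \<in> ?A. ?f x \<in> hyperoct_desc (Suc N) {m}} = ?T"
  proof (intro set_eqI, clarify)
    fix u p and s :: int
    show "(u, p, s) \<in> {x \<in> ?A. ?f x \<in> hyperoct_desc (Suc N) {m}} \<longleftrightarrow> (u, p, s) \<in> ?T"
    proof (cases "u \<in> hyperoct N \<and> p \<in> {1..Suc N} \<and> s \<in> {1, - 1}")
      case True
      then show ?thesis
        using comp_insertion_hyperoct_desc_iff[of u N p s m] \<open>m \<le> N\<close> by auto
    next
      case False
      then show ?thesis using \<open>m \<le> N\<close> by (auto dest: hyperoct_descD)
    qed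
  qed
  ultimately show ?thesis by simp
qed

lemma sum_hyperoct_desc_Suc:
  assumes "m \<le> N"
  shows "(\<Sum>w\<in>hyperoct_desc (Suc N) {m}. F w) =
    (\<Sum>u\<in>hyperoct_desc N {m}. F u) +
    (if m = 0 then 0 else \<Sum>u\<in>hyperoct_desc N {m - 1}. F (u \<circ> insertion N m 1)) +
    (\<Sum>u\<in>hyperoct_desc N {m}. F (u \<circ> insertion N (Suc m) (- 1)))"
proof -
  let ?f = "\<lambda>(u, p, s). u \<circ> insertion N p s"
  let ?A = "hyperoct_desc N {m} \<times> {(Suc N, 1)}"
    and ?B = "if m = 0 then {} else hyperoct_desc N {m - 1} \<times> {(m, 1)}"
    and ?C = "hyperoct_desc N {m} \<times> {(Suc m, - 1)}"
  have fin: "finite ?A" "finite ?B" "finite ?C" by (simp_all add: finite_hyperoct_desc)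
  have "(\<Sum>w\<in>hyperoct_desc (Suc N) {m}. F w) = (\<Sum>x\<in>?A \<union> ?B \<union> ?C. F (?f x))"
    by (rule sum.reindex_bij_betw[OF hyperoct_desc_Suc_bij[OF assms], symmetric])
  also have "\<dots> = (\<Sum>x\<in>?A. F (?f x)) + (\<Sum>x\<in>?B. F (?f x)) + (\<Sum>x\<in>?C. F (?f x))"
    using fin assms by (subst sum.union_disjoint, (auto)[3], subst sum.union_disjoint) auto
  also have "(\<Sum>x\<in>?A. F (?f x)) = (\<Sum>u\<in>hyperoct_desc N {m}. F u)"
    by (simp add: sum.cartesian_product' insertion_last)
  also have "(\<Sum>x\<in>?B. F (?f x)) =
      (if m = 0 then 0 else \<Sum>u\<in>hyperoct_desc N {m - 1}. F (u \<circ> insertion N m 1))"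
    by (simp add: sum.cartesian_product')
  also have "(\<Sum>x\<in>?C. F (?f x)) = (\<Sum>u\<in>hyperoct_desc N {m}. F (u \<circ> insertion N (Suc m) (- 1)))"
    by (simp add: sum.cartesian_product')
  finally show ?thesis .
qed

section \<open>The sums with a single descent\<close>

text \<open>
  For \<open>d = True\<close> the parity condition is reversed for the pairs that straddle \<open>m\<close>: inserting a value
  at position \<open>m\<close> or \<open>m + 1\<close> shifts the positions to the right by one.
\<close>
definition block_parity :: "bool \<Rightarrow> nat \<Rightarrow> int \<Rightarrow> int \<Rightarrow> bool" where
  "block_parity d m a b \<longleftrightarrow> odd (a + b) \<noteq> (d \<and> a \<le> int m \<and> int m < b)"

definition block_sum :: "bool \<Rightarrow> nat \<Rightarrow> nat \<Rightarrow> int poly" where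
  "block_sum d m k = (\<Sum>u\<in>hyperoct_desc (m + k) {m}. weight (block_parity d m) (m + k) u)"

lemma block_parity_False: "block_parity False m = opposite_parity"
  by (simp add: fun_eq_iff block_parity_def opposite_parity_def)

lemma block_parity_skip:
  assumes "1 \<le> p" "m = p \<or> Suc m = p" "0 \<le> a" "a < b"
  shows "block_parity d m (skip p a) (skip p b) \<longleftrightarrow> block_parity (\<not> d) (p - 1) a b"
  using assms by (auto simp: block_parity_def skip_def of_nat_diff)

lemma card_parity_interval:
  "card {j \<in> {a..<a + int k}. even (a + j) = b} = (if b then Suc k else k) div 2"
proof (induction k)
  case (Suc k)
  let ?S = "\<lambda>k. {j \<in> {a..<a + int k}. even (a + j) = b}"
  have "?S (Suc k) = (if even k = b then insert (a + int k) (?S k) else ?S k)"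
    by (auto simp: less_le)
  moreover have "finite (?S k)" by (rule finite_subset[of _ "{a..<a + int k}"]) auto
  ultimately have "card (?S (Suc k)) = (if even k = b then Suc (card (?S k)) else card (?S k))"
    by simp
  then show ?case
    unfolding Suc.IH by (cases b; cases "even k") simp_all
qed simp

lemma coxeter_sign_comp_insertion:
  assumes u: "u \<in> hyperoct N" and p: "p \<in> {1..Suc N}" and s: "s \<in> {1, - 1}"
  shows "coxeter_sign (Suc N) (u \<circ> insertion N p s) =
    (of_int s * (- 1) ^ (Suc N - p) * coxeter_sign N u :: 'a::comm_ring_1)"
proof -
  have "{i. \<bar>i\<bar> < int p \<and> True} = {- int p + 1..int p - 1}"
    "{j \<in> {int p<..int N + 1}. True} = {int p + 1..int N + 1}" by auto
  then have "card {i. \<bar>i\<bar> < int p \<and> True} = 2 * p - 1"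
    "card {j \<in> {int p<..int N + 1}. True} = Suc N - p"
    using p by (simp_all only: card_atLeastAtMost_int)
  then have "card (inversions all_pairs (Suc N) (u \<circ> insertion N p s)) =
      card (inversions all_pairs N u) + (if s = 1 then 0 else 2 * p - 1) + (Suc N - p)"
    by (simp only: card_inversions_comp_insertion[OF u p s])
  moreover have "(- 1 :: 'a) ^ (if s = 1 then 0 else 2 * p - 1) = of_int s"
    using s p by auto
  ultimately show ?thesis
    by (simp only: coxeter_sign_def power_add mult_ac)
qed

lemma weight_comp_insertion:
  assumes "u \<in> hyperoct N" "p \<in> {1..Suc N}" "s \<in> {1, - 1}"
  shows "weight Q (Suc N) (u \<circ> insertion N p s) =
    of_int s * (- 1) ^ (Suc N - p) *
    monom 1 ((if s = 1 then 0 else card {i. \<bar>i\<bar> < int p \<and> Q \<bar>i\<bar> (int p)}) +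
      card {j \<in> {int p<..int N + 1}. Q (int p) j}) *
    weight (\<lambda>a b. Q (skip p a) (skip p b)) N u"
  by (simp only: weight_def coxeter_sign_comp_insertion[OF assms]
      card_inversions_comp_insertion[OF assms, of Q] monom_1_add add.assoc mult_ac)

lemma weight_block_parity_skip:
  assumes "1 \<le> p" "m = p \<or> Suc m = p"
  shows "weight (\<lambda>a b. block_parity d m (skip p a) (skip p b)) N u =
    weight (block_parity (\<not> d) (p - 1)) N u"
  unfolding weight_def by (subst inversions_cong[OF block_parity_skip[OF assms]]) simp_all

lemma weight_insertion_max:
  assumes u: "u \<in> hyperoct N" and m: "1 \<le> m" "m + k = Suc N"
  shows "weight (block_parity d m) (Suc N) (u \<circ> insertion N m 1) =
    (- 1) ^ k * monom 1 ((if d then k else Suc k) div 2) * weight (block_parity (\<not> d) (m - 1)) N u"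
proof -
  have "{j \<in> {int m<..int N + 1}. block_parity d m (int m) j} =
      {j \<in> {int m + 1..<int m + 1 + int k}. even (int m + 1 + j) = (\<not> d)}"
    using m by (auto simp: block_parity_def)
  then have "card {j \<in> {int m<..int N + 1}. block_parity d m (int m) j} =
      (if d then k else Suc k) div 2"
    by (simp only: card_parity_interval) simp
  moreover have "Suc N - m = k" using m by simp
  ultimately show ?thesis
    using weight_comp_insertion[OF u, of m 1 "block_parity d m"] m
    by (simp add: weight_block_parity_skip del: comp_apply)
qed

lemma weight_insertion_min:
  assumes u: "u \<in> hyperoct N" and N: "N = m + k"
  shows "weight (block_parity d m) (Suc N) (u \<circ> insertion N (Suc m) (- 1)) =
    (- 1) ^ Suc k * monom 1 ((if d then m else Suc m) + Suc k div 2) *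
      weight (block_parity (\<not> d) m) N u"
proof -
  have "{i. \<bar>i\<bar> < int (Suc m) \<and> block_parity d m \<bar>i\<bar> (int (Suc m))} =
      {i \<in> {- int m..<- int m + int (2 * m + 1)}. even (- int m + i) = (\<not> d)}"
    by (auto simp: block_parity_def)
  then have inner: "card {i. \<bar>i\<bar> < int (Suc m) \<and> block_parity d m \<bar>i\<bar> (int (Suc m))} =
      (if d then m else Suc m)"
    by (simp only: card_parity_interval) simp
  have "{j \<in> {int (Suc m)<..int N + 1}. block_parity d m (int (Suc m)) j} =
      {j \<in> {int m + 2..<int m + 2 + int k}. even (int m + 2 + j) = True}"
    using N by (auto simp: block_parity_def)
  then have outer: "card {j \<in> {int (Suc m)<..int N + 1}. block_parity d m (int (Suc m)) j} =
      Suc k div 2"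
    by (simp only: card_parity_interval) simp
  have "Suc N - Suc m = k" using N by simp
  then show ?thesis
    using weight_comp_insertion[OF u, of "Suc m" "- 1" "block_parity d m"] N inner outer
    by (simp add: weight_block_parity_skip del: comp_apply)
qed

lemma weight_hyperoct_Suc: "u \<in> hyperoct N \<Longrightarrow> weight Q (Suc N) u = weight Q N u"
  using inversions_hyperoct_mono[of u N "Suc N"] coxeter_sign_mono[of u N "Suc N"]
  by (simp add: weight_def)

lemma block_sum_0: "block_sum d m 0 = 1"
  using hyperoct_desc_no_descents[of "{m}" m] by (simp add: block_sum_def weight_id del: id_apply)

lemma block_sum_Suc:
  "block_sum d m (Suc k) = block_sum d m k +
    (- 1) ^ Suc k * monom 1 ((if d then Suc k else Suc (Suc k)) div 2) *
      (if m = 0 then 0 else block_sum (\<not> d) (m - 1) (Suc k)) +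
    (- 1) ^ Suc k * monom 1 ((if d then m else Suc m) + Suc k div 2) * block_sum (\<not> d) m k"
proof -
  let ?N = "m + k"
  let ?wt = "weight (block_parity d m) (Suc ?N)"
  have "(\<Sum>u\<in>hyperoct_desc ?N {m}. ?wt u) = block_sum d m k"
    unfolding block_sum_def by (rule sum.cong) (simp_all add: weight_hyperoct_Suc hyperoct_descD)
  moreover have "(if m = 0 then 0 else \<Sum>u\<in>hyperoct_desc ?N {m - 1}. ?wt (u \<circ> insertion ?N m 1)) =
      (- 1) ^ Suc k * monom 1 ((if d then Suc k else Suc (Suc k)) div 2) *
        (if m = 0 then 0 else block_sum (\<not> d) (m - 1) (Suc k))"
  proof (cases "m = 0")
    case False
    then have N: "m - 1 + Suc k = ?N" by simp
    have "(\<Sum>u\<in>hyperoct_desc ?N {m - 1}. ?wt (u \<circ> insertion ?N m 1)) =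
        (- 1) ^ Suc k * monom 1 ((if d then Suc k else Suc (Suc k)) div 2) *
          block_sum (\<not> d) (m - 1) (Suc k)"
      unfolding block_sum_def sum_distrib_left N
      by (intro sum.cong refl weight_insertion_max hyperoct_descD[of _ ?N "{m - 1}"])
         (use False in auto)
    then show ?thesis using False by (simp only: if_False)
  qed simp
  moreover have "(\<Sum>u\<in>hyperoct_desc ?N {m}. ?wt (u \<circ> insertion ?N (Suc m) (- 1))) =
      (- 1) ^ Suc k * monom 1 ((if d then m else Suc m) + Suc k div 2) * block_sum (\<not> d) m k"
    unfolding block_sum_def sum_distrib_left
    by (intro sum.cong refl weight_insertion_min hyperoct_descD[of _ ?N "{m}"])
  moreover have "block_sum d m (Suc k) = (\<Sum>u\<in>hyperoct_desc (Suc ?N) {m}. ?wt u)"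
    by (simp add: block_sum_def)
  ultimately show ?thesis
    by (simp only: sum_hyperoct_desc_Suc[OF le_add1])
qed

section \<open>Closed form\<close>

abbreviation fract_X :: "nat \<Rightarrow> int poly fract" where
  "fract_X e \<equiv> to_fract (monom 1 e)"

definition block_quot :: "nat \<Rightarrow> nat \<Rightarrow> int poly fract" where
  "block_quot m k = to_fract (qfact (m + k)) / to_fract (qfact m * qdfact k)"

definition block_quot_pred :: "nat \<Rightarrow> nat \<Rightarrow> int poly fract" where
  "block_quot_pred m k = (if m = 0 then 0 else block_quot (m - 1) k)"

lemma qnum_nonzero: "qnum k \<noteq> 0"
proof
  assume "qnum k = 0"
  then have "coeff (qnum k) 0 = 0" by simp
  then show False by (simp add: qnum_def split: if_splits)
qed

lemma qfact_nonzero: "qfact k \<noteq> 0"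
  by (simp add: qfact_def qnum_nonzero)

lemma qdfact_nonzero: "qdfact k \<noteq> 0"
  by (simp add: qdfact_def qnum_nonzero)

lemma qfact_Suc: "qfact (Suc k) = qfact k * qnum (Suc k)"
  by (simp add: qfact_def)

lemma qdfact_0: "qdfact 0 = 1"
  by (simp add: qdfact_def)

lemma qdfact_Suc: "qdfact (Suc k) = (if odd k then qdfact k * qnum (Suc k) else qdfact k)"
proof -
  have "{i \<in> {1..Suc k}. even i} =
      (if odd k then insert (Suc k) {i \<in> {1..k}. even i} else {i \<in> {1..k}. even i})"
    by (auto simp: le_Suc_eq)
  then show ?thesis by (simp add: qdfact_def mult.commute)
qed

lemma to_fract_qnum_Suc: "to_fract (qnum (Suc k)) = 1 - fract_X (Suc k)"
  by (simp add: qnum_def)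

lemma fract_X_add: "fract_X (a + b) = fract_X a * fract_X b"
  by (simp only: monom_1_add to_fract_mult)

lemma fract_X_0: "fract_X 0 = 1"
  by (simp add: monom_0 flip: one_pCons)

lemma one_minus_fract_X_nonzero: "1 - fract_X (Suc k) \<noteq> 0"
  using qnum_nonzero[of "Suc k"] by (simp flip: to_fract_qnum_Suc)

lemma block_quot_0: "block_quot m 0 = 1"
  by (simp add: block_quot_def qdfact_0 qfact_nonzero)

lemma block_quot_Suc:
  "block_quot m (Suc k) * (if odd k then 1 - fract_X (Suc k) else 1) =
     block_quot m k * (1 - fract_X m * fract_X (Suc k))"
  using one_minus_fract_X_nonzero[of k] fract_X_add[of m "Suc k"]
  by (simp add: block_quot_def qfact_Suc qdfact_Suc to_fract_qnum_Suc)

lemma block_quot_pred_Suc: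
  "block_quot_pred m (Suc k) * (if odd k then 1 - fract_X (Suc k) else 1) =
     block_quot m k * (1 - fract_X m)"
proof (cases m)
  case 0
  then show ?thesis by (simp add: block_quot_pred_def fract_X_0)
next
  case (Suc l)
  then show ?thesis
    using one_minus_fract_X_nonzero[of k] one_minus_fract_X_nonzero[of l]
      qfact_nonzero[of l] qdfact_nonzero[of k]
    by (simp add: block_quot_pred_def block_quot_def qfact_Suc qdfact_Suc to_fract_qnum_Suc
        field_simps)
qed

lemma block_quot_recurrence_odd:
  assumes "odd k"
  shows "block_quot m (Suc k) = block_quot m k + fract_X (Suc k) * block_quot_pred m (Suc k)"
    and "block_quot m (Suc k) = block_quot_pred m (Suc k) + fract_X m * block_quot m k"
proof -
  let ?c = "1 - fract_X (Suc k)"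
  have quot: "block_quot m (Suc k) * ?c = block_quot m k * (1 - fract_X m * fract_X (Suc k))"
    and pred: "block_quot_pred m (Suc k) * ?c = block_quot m k * (1 - fract_X m)"
    using block_quot_Suc[of m k] block_quot_pred_Suc[of m k] assms by simp_all
  have "(block_quot m k + fract_X (Suc k) * block_quot_pred m (Suc k)) * ?c =
      block_quot m k * ?c + fract_X (Suc k) * (block_quot_pred m (Suc k) * ?c)"
    by (simp only: distrib_right mult.assoc)
  also have "\<dots> = block_quot m (Suc k) * ?c" unfolding quot pred by (simp add: algebra_simps)
  finally show "block_quot m (Suc k) = block_quot m k + fract_X (Suc k) * block_quot_pred m (Suc k)"
    using one_minus_fract_X_nonzero[of k] by (metis mult_right_cancel)
  have "(block_quot_pred m (Suc k) + fract_X m * block_quot m k) * ?c =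
      block_quot_pred m (Suc k) * ?c + fract_X m * (block_quot m k * ?c)"
    by (simp only: distrib_right mult.assoc)
  also have "\<dots> = block_quot m (Suc k) * ?c" unfolding quot pred by (simp add: algebra_simps)
  finally show "block_quot m (Suc k) = block_quot_pred m (Suc k) + fract_X m * block_quot m k"
    using one_minus_fract_X_nonzero[of k] by (metis mult_right_cancel)
qed

definition block_sums_closed :: "nat \<Rightarrow> nat \<Rightarrow> bool" where
  "block_sums_closed m k \<longleftrightarrow> to_fract (block_sum False m k) = block_quot m k \<and>
     to_fract (block_sum True m k) = (if even k then fract_X (k div 2) * block_quot m k else 0)"

lemma block_sums_closed_recurrence:
  assumes "block_sums_closed m k" and "m = 0 \<or> block_sums_closed (m - 1) (Suc k)"
  shows "to_fract (block_sum False m (Suc k)) = block_quot m k +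
      (- 1) ^ Suc k * fract_X (Suc (Suc k) div 2) *
        (if even (Suc k) then fract_X (Suc k div 2) * block_quot_pred m (Suc k) else 0) +
      (- 1) ^ Suc k * fract_X (Suc m + Suc k div 2) *
        (if even k then fract_X (k div 2) * block_quot m k else 0)"
    and "to_fract (block_sum True m (Suc k)) =
      (if even k then fract_X (k div 2) * block_quot m k else 0) +
      (- 1) ^ Suc k * fract_X (Suc k div 2) * block_quot_pred m (Suc k) +
      (- 1) ^ Suc k * fract_X (m + Suc k div 2) * block_quot m k"
proof -
  have current: "to_fract (block_sum False m k) = block_quot m k"
    "to_fract (block_sum True m k) = (if even k then fract_X (k div 2) * block_quot m k else 0)"
    using assms(1) by (simp_all add: block_sums_closed_def)
  have pred: "to_fract (if m = 0 then 0 else block_sum False (m - 1) (Suc k)) =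
      block_quot_pred m (Suc k)"
    "to_fract (if m = 0 then 0 else block_sum True (m - 1) (Suc k)) =
       (if even (Suc k) then fract_X (Suc k div 2) * block_quot_pred m (Suc k) else 0)"
    using assms(2) by (cases "m = 0"; simp add: block_sums_closed_def block_quot_pred_def)+
  have sign: "to_fract ((- 1) ^ Suc k) = (- 1) ^ Suc k" by (induction k) simp_all
  note expand = block_sum_Suc[of _ m k] to_fract_add to_fract_mult sign not_True_eq_False
    not_False_eq_True if_True if_False
  show "to_fract (block_sum False m (Suc k)) = block_quot m k +
      (- 1) ^ Suc k * fract_X (Suc (Suc k) div 2) *
        (if even (Suc k) then fract_X (Suc k div 2) * block_quot_pred m (Suc k) else 0) +
      (- 1) ^ Suc k * fract_X (Suc m + Suc k div 2) *
        (if even k then fract_X (k div 2) * block_quot m k else 0)"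
    by (simp only: expand current pred)
  show "to_fract (block_sum True m (Suc k)) =
      (if even k then fract_X (k div 2) * block_quot m k else 0) +
      (- 1) ^ Suc k * fract_X (Suc k div 2) * block_quot_pred m (Suc k) +
      (- 1) ^ Suc k * fract_X (m + Suc k div 2) * block_quot m k"
    by (simp only: expand current pred)
qed

lemma block_sums_closed_Suc:
  assumes "block_sums_closed m k" and "m = 0 \<or> block_sums_closed (m - 1) (Suc k)"
  shows "block_sums_closed m (Suc k)"
proof -
  let ?a = "block_quot m k" and ?b = "block_quot_pred m (Suc k)" and ?K = "Suc k"
  note rec = block_sums_closed_recurrence[OF assms]
  show ?thesis
  proof (cases "even k")
    case True
    then obtain h where k: "k = 2 * h" by (elim evenE)
    have half: "k div 2 = h" "?K div 2 = h" using k by simp_all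
    have quot: "block_quot m ?K = ?a * (1 - fract_X m * fract_X ?K)" "?b = ?a * (1 - fract_X m)"
      using True block_quot_Suc[of m k] block_quot_pred_Suc[of m k] by simp_all
    have "fract_X (Suc m + h) * fract_X h = fract_X m * fract_X ?K"
      by (simp add: k mult_2 add.assoc flip: fract_X_add)
    then have "to_fract (block_sum False m ?K) = block_quot m ?K"
      using True unfolding rec half quot by (simp add: algebra_simps)
    moreover have "to_fract (block_sum True m ?K) = 0"
      using True unfolding rec half quot by (simp add: fract_X_add algebra_simps)
    ultimately show ?thesis using True by (simp add: block_sums_closed_def)
  next
    case False
    then obtain h where k: "?K = 2 * h" by (metis even_Suc evenE)
    have half: "?K div 2 = h" "Suc ?K div 2 = h" using k by simp_all
    have "fract_X ?K = fract_X h * fract_X h" by (simp add: k mult_2 flip: fract_X_add)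
    then have "to_fract (block_sum False m ?K) = ?a + fract_X ?K * ?b"
      "to_fract (block_sum True m ?K) = fract_X h * (?b + fract_X m * ?a)"
      using False unfolding rec half by (simp_all add: fract_X_add algebra_simps)
    then show ?thesis
      using block_quot_recurrence_odd[OF False] False half by (simp add: block_sums_closed_def)
  qed
qed

lemma block_sums_closed: "block_sums_closed m k"
proof (induction k arbitrary: m)
  case 0
  show ?case by (simp add: block_sums_closed_def block_sum_0 block_quot_0 fract_X_0)
next
  case (Suc k)
  show ?case
  proof (induction m)
    case 0
    show ?case by (rule block_sums_closed_Suc[OF Suc.IH]) simp
  next
    case (Suc m)
    show ?case by (rule block_sums_closed_Suc[OF \<open>\<And>m. block_sums_closed m k\<close>]) (simp add: Suc)
  qed
qed

lemma signed_sum_singleton: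
  assumes "m < n"
  shows "to_fract (signed_sum n {m}) = block_quot m (n - m)"
proof -
  have "signed_sum n {m} = block_sum False m (n - m)"
    using assms by (simp add: signed_sum_def block_sum_def block_parity_False)
  then show ?thesis using block_sums_closed by (simp add: block_sums_closed_def)
qed

lemma sorted_list_of_set_insert_greater:
  fixes A :: "'a::linorder set"
  assumes "finite A" and "\<And>a. a \<in> A \<Longrightarrow> a < x"
  shows "sorted_list_of_set (insert x A) = sorted_list_of_set A @ [x]"
proof (rule sorted_distinct_set_unique)
  show "sorted (sorted_list_of_set A @ [x])"
    using assms by (auto simp: sorted_append less_imp_le)
  show "distinct (sorted_list_of_set A @ [x])"
    using assms by auto
  show "set (sorted_list_of_set (insert x A)) = set (sorted_list_of_set A @ [x])"
    using assms(1) set_sorted_list_of_set[of "insert x A"] by simp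
qed (rule sorted_sorted_list_of_set distinct_sorted_list_of_set)+

lemma elt_insert_greater:
  assumes J: "J \<subseteq> {..<m}"
  shows "1 \<le> t \<Longrightarrow> t \<le> card J \<Longrightarrow> elt (insert m J) t = elt J t"
    and "elt (insert m J) (Suc (card J)) = m"
proof -
  have "finite J" using J finite_subset by blast
  then have "sorted_list_of_set (insert m J) = sorted_list_of_set J @ [m]"
    using J by (intro sorted_list_of_set_insert_greater) auto
  then show "1 \<le> t \<Longrightarrow> t \<le> card J \<Longrightarrow> elt (insert m J) t = elt J t"
    "elt (insert m J) (Suc (card J)) = m"
    using \<open>finite J\<close> by (auto simp: elt_def nth_append)
qed

lemma f_frac_insert:
  assumes "m < n" and J: "J \<subseteq> {..<m}"
  shows "f_frac n (insert m J) = block_quot m (n - m) * f_frac m J"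
proof -
  have fin: "finite J" using J finite_subset by blast
  have card: "card (insert m J) = Suc (card J)" using J fin by (subst card_insert_disjoint) auto
  note elt = elt_insert_greater[OF J]
  have n: "m + (n - m) = n" using \<open>m < n\<close> by simp
  show ?thesis
  proof (cases "J = {}")
    case True
    then show ?thesis using elt(2) n by (simp add: f_frac_def gap_def block_quot_def)
  next
    case False
    then have pos: "1 \<le> card J" using fin by (simp add: Suc_le_eq card_gt_0_iff)
    have gap_J: "gap n (insert m J) t = gap m J t" if "1 \<le> t" "t \<le> card J" for t
      using that elt(1)[of t] elt(1)[of "t + 1"] elt(2)
      by (cases "t = card J") (auto simp: gap_def card)
    have gap_last: "gap n (insert m J) (Suc (card J)) = n - m"
      by (simp add: gap_def card elt(2))
    have "(\<Prod>t = 1..card (insert m J). qdfact (gap n (insert m J) t)) =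
        (\<Prod>t = 1..card J. qdfact (gap m J t)) * qdfact (n - m)"
      unfolding card using gap_J by (simp add: gap_last prod.nat_ivl_Suc')
    moreover have "to_fract (qfact m) \<noteq> 0" by (simp add: qfact_nonzero)
    ultimately show ?thesis
      using False elt(1)[of 1] pos n by (simp add: f_frac_def block_quot_def field_simps)
  qed
qed

lemma signed_sum_eq_f_frac:
  assumes "I \<subseteq> {..<n}"
  shows "to_fract (signed_sum n I) = f_frac n I"
proof -
  have "finite I" using assms finite_subset by blast
  then show ?thesis using assms
  proof (induction I arbitrary: n rule: finite_linorder_max_induct)
    case empty
    then show ?case
      by (simp add: signed_sum_def hyperoct_desc_no_descents weight_id f_frac_def del: id_apply)
  next
    case (insert m J)
    then have m: "m < n" and J: "J \<subseteq> {..<m}" by auto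
    have "to_fract (signed_sum n (insert m J)) = block_quot m (n - m) * to_fract (signed_sum m J)"
      by (simp only: signed_sum_insert[OF m J] to_fract_mult signed_sum_singleton[OF m])
    also have "\<dots> = f_frac n (insert m J)"
      by (simp only: insert.IH[OF J] f_frac_insert[OF m J])
    finally show ?case .
  qed
qed

theorem theorem2p16:
  fixes n :: nat and I :: "nat set"
  assumes "n \<ge> 1" and "I \<subseteq> {0..n - 1}"
  shows "to_fract (\<Sum>w\<in>hyperoct_desc n I. (- 1) ^ coxeter_length n w * monom 1 (odd_length n w)) =
         f_frac n I"
proof -
  have "I \<subseteq> {..<n}" using assms by (auto simp: subset_iff)
  then show ?thesis by (simp only: signed_sum_eq_f_frac flip: signed_sum_eq)
qed

end
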